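(* Let $R$ be a ring and let $n,k$ be non-negative integers. Then: (1) For every short exact sequence $0\to A\to B\to C\to 0$ of left $R$-modules, if $A$ and $B$ are in $\mathcal{WI}_k^n(R)$, then $C$ is in $\mathcal{WI}_k^n(R)$. (2) For every short exact sequence $0\to A\to B\to C\to 0$ of right $R$-modules, if $B$ and $C$ are in $\mathcal{WF}_k^n(R^{op})$, then $A$ is in $\mathcal{WF}_k^n(R^{op})$.
   Context: Rings are associative with identity and modules are unitary. A left $R$-module $U$ is $n$-super finitely presented if there is an exact sequence $\cdots\to F_{n+1}\to F_n\to\cdots\to F_1\to F_0\to U\to 0$ of projective left $R$-modules with $F_i$ finitely generated for every $i\ge n$. For such a sequence put $K_i=\mathrm{Im}(F_{i+1}\to F_i)$ for $i\ge 0$ and $K_{-1}=U$; the module $K_{n-1}$ is called a special super finitely presented left $R$-module (relative to $n$). For a left module $M$, $n\text{-}\mathrm{wid}_R(M)=\inf\{k\ge 0:\mathrm{Ext}_R^{k+1}(K_{n-1},M)=0$ for every special super finitely presented left $R$-module $K_{n-1}\}$; for a right module $N$, $n\text{-}\mathrm{wfd}_R(N)=\inf\{k\ge 0:\mathrm{Tor}^R_{k+1}(N,K_{n-1})=0$ for every special super finitely presented left $R$-module $K_{n-1}\}$. $\mathcal{WI}_k^n(R)$ is the class of left $R$-modules $M$ with $n\text{-}\mathrm{wid}_R(M)\le k$, and $\mathcal{WF}_k^n(R^{op})$ is the class of right $R$-modules $N$ with $n\text{-}\mathrm{wfd}_R(N)\le k$. *)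

theory Defs
  imports "HOL-Algebra.Module" "HOL-Algebra.AbelCoset" "HOL-Algebra.Free_Abelian_Groups" "HOL-Library.Extended_Nat"
begin

section \<open>Modules over a not necessarily commutative ring\<close>

text \<open>
  The record \<open>module\<close> of HOL-Algebra is reused, but its locale \<open>module\<close> assumes a commutative
  ring. The ring multiplication fields of a module record play no role.
\<close>

locale left_module = R?: ring R + M?: abelian_group M
  for R :: "('r, 'x) ring_scheme" (structure) and M :: "('r, 'm) module" (structure) +
  assumes smult_closed [simp, intro]:
      "\<lbrakk>a \<in> carrier R; x \<in> carrier M\<rbrakk> \<Longrightarrow> a \<odot>\<^bsub>M\<^esub> x \<in> carrier M"
    and smult_l_distr:
      "\<lbrakk>a \<in> carrier R; b \<in> carrier R; x \<in> carrier M\<rbrakk>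
        \<Longrightarrow> (a \<oplus> b) \<odot>\<^bsub>M\<^esub> x = a \<odot>\<^bsub>M\<^esub> x \<oplus>\<^bsub>M\<^esub> b \<odot>\<^bsub>M\<^esub> x"
    and smult_r_distr:
      "\<lbrakk>a \<in> carrier R; x \<in> carrier M; y \<in> carrier M\<rbrakk>
        \<Longrightarrow> a \<odot>\<^bsub>M\<^esub> (x \<oplus>\<^bsub>M\<^esub> y) = a \<odot>\<^bsub>M\<^esub> x \<oplus>\<^bsub>M\<^esub> a \<odot>\<^bsub>M\<^esub> y"
    and smult_assoc:
      "\<lbrakk>a \<in> carrier R; b \<in> carrier R; x \<in> carrier M\<rbrakk>
        \<Longrightarrow> (a \<otimes> b) \<odot>\<^bsub>M\<^esub> x = a \<odot>\<^bsub>M\<^esub> (b \<odot>\<^bsub>M\<^esub> x)"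
    and smult_one [simp]: "x \<in> carrier M \<Longrightarrow> \<one> \<odot>\<^bsub>M\<^esub> x = x"

definition opposite_ring :: "('r, 'x) ring_scheme \<Rightarrow> ('r, 'x) ring_scheme" where
  "opposite_ring R = R\<lparr>monoid.mult := \<lambda>a b. b \<otimes>\<^bsub>R\<^esub> a\<rparr>"

text \<open>For a right module \<open>N\<close>, the term \<open>a \<odot>\<^bsub>N\<^esub> x\<close> is what is usually written \<open>x a\<close>.\<close>

abbreviation right_module :: "('r, 'x) ring_scheme \<Rightarrow> ('r, 'm) module \<Rightarrow> bool" where
  "right_module R N \<equiv> left_module (opposite_ring R) N"

text \<open>Only the carrier of \<open>R\<close> enters here, so the same notion serves left and right modules.\<close>

definition mod_hom ::
    "('r, 'x) ring_scheme \<Rightarrow> ('r, 'm) module \<Rightarrow> ('r, 'n) module \<Rightarrow> ('m \<Rightarrow> 'n) set" where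
  "mod_hom R M N = {h \<in> carrier M \<rightarrow> carrier N.
     (\<forall>x\<in>carrier M. \<forall>y\<in>carrier M. h (x \<oplus>\<^bsub>M\<^esub> y) = h x \<oplus>\<^bsub>N\<^esub> h y) \<and>
     (\<forall>a\<in>carrier R. \<forall>x\<in>carrier M. h (a \<odot>\<^bsub>M\<^esub> x) = a \<odot>\<^bsub>N\<^esub> h x)}"

definition short_exact ::
    "('r, 'x) ring_scheme \<Rightarrow> ('r, 'a) module \<Rightarrow> ('r, 'b) module \<Rightarrow> ('r, 'c) module
      \<Rightarrow> ('a \<Rightarrow> 'b) \<Rightarrow> ('b \<Rightarrow> 'c) \<Rightarrow> bool" where
  "short_exact R A B C f g \<longleftrightarrow>
     left_module R A \<and> left_module R B \<and> left_module R C \<and>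
     f \<in> mod_hom R A B \<and> g \<in> mod_hom R B C \<and>
     inj_on f (carrier A) \<and> f ` carrier A = a_kernel B C g \<and> g ` carrier B = carrier C"

definition fin_gen :: "('r, 'x) ring_scheme \<Rightarrow> ('r, 'm) module \<Rightarrow> bool" where
  "fin_gen R M \<longleftrightarrow> (\<exists>S. finite S \<and> S \<subseteq> carrier M \<and>
     (\<forall>x\<in>carrier M. \<exists>c \<in> S \<rightarrow> carrier R. x = (\<Oplus>\<^bsub>M\<^esub>s\<in>S. c s \<odot>\<^bsub>M\<^esub> s)))"

text \<open>
  The lifting property. The test modules \<open>M\<close> and \<open>N\<close> have to live in fixed types; with the types
  chosen here the free module on the set \<open>carrier P\<close> is among the \<open>M\<close>, so that \<open>P\<close> is a direct
  summand of it and lifts against every surjection, between modules of whatever types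
  (lemma \<open>projective_lift\<close> below).
\<close>

definition projective :: "('r, 'x) ring_scheme \<Rightarrow> ('r, 'm) module \<Rightarrow> bool" where
  "projective R P \<longleftrightarrow> left_module R P \<and>
     (\<forall>(M :: ('r, 'm \<Rightarrow> 'r) module) (N :: ('r, 'm) module) g f.
        left_module R M \<and> left_module R N \<and> g \<in> mod_hom R M N \<and> g ` carrier M = carrier N \<and>
        f \<in> mod_hom R P N \<longrightarrow>
        (\<exists>h \<in> mod_hom R P M. \<forall>x\<in>carrier P. g (h x) = f x))"

text \<open>Exactness of \<open>\<dots> \<rightarrow> F 2 \<rightarrow> F 1 \<rightarrow> F 0 \<rightarrow> U \<rightarrow> 0\<close> with maps \<open>\<dots>, d 1, d 0, e\<close>.\<close>

definition exact_resolution ::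
    "('r, 'x) ring_scheme \<Rightarrow> ('r, 'u) module \<Rightarrow> (nat \<Rightarrow> ('r, 'm) module)
      \<Rightarrow> ('m \<Rightarrow> 'u) \<Rightarrow> (nat \<Rightarrow> 'm \<Rightarrow> 'm) \<Rightarrow> bool" where
  "exact_resolution R U F e d \<longleftrightarrow>
     left_module R U \<and> (\<forall>i. left_module R (F i)) \<and>
     e \<in> mod_hom R (F 0) U \<and> (\<forall>i. d i \<in> mod_hom R (F (Suc i)) (F i)) \<and>
     e ` carrier (F 0) = carrier U \<and>
     d 0 ` carrier (F (Suc 0)) = a_kernel (F 0) U e \<and>
     (\<forall>i. d (Suc i) ` carrier (F (Suc (Suc i))) = a_kernel (F (Suc i)) (F i) (d i))"

section \<open>A free resolution of a module\<close>

definition free_module :: "('r, 'x) ring_scheme \<Rightarrow> 'b set \<Rightarrow> ('r, 'b \<Rightarrow> 'r) module" where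
  "free_module R B =
     \<lparr>carrier = {v. (\<forall>b. v b \<in> carrier R) \<and> (\<forall>b. b \<notin> B \<longrightarrow> v b = \<zero>\<^bsub>R\<^esub>) \<and> finite {b. v b \<noteq> \<zero>\<^bsub>R\<^esub>}},
      monoid.mult = undefined, one = undefined,
      ring.zero = (\<lambda>_. \<zero>\<^bsub>R\<^esub>), ring.add = (\<lambda>v w b. v b \<oplus>\<^bsub>R\<^esub> w b),
      module.smult = (\<lambda>a v b. a \<otimes>\<^bsub>R\<^esub> v b)\<rparr>"

text \<open>The linear map out of a free module with prescribed values \<open>g\<close> on the basis.\<close>

definition lin_ext ::
    "('r, 'x) ring_scheme \<Rightarrow> ('r, 'm) module \<Rightarrow> ('b \<Rightarrow> 'm) \<Rightarrow> ('b \<Rightarrow> 'r) \<Rightarrow> 'm" where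
  "lin_ext R M g v = (\<Oplus>\<^bsub>M\<^esub>b\<in>{b. v b \<noteq> \<zero>\<^bsub>R\<^esub>}. v b \<odot>\<^bsub>M\<^esub> g b)"

text \<open>The element \<open>a\<^sub>1 b\<^sub>1 + \<dots> + a\<^sub>m b\<^sub>m\<close> of a free module, for the list \<open>[(a\<^sub>1, b\<^sub>1), \<dots>, (a\<^sub>m, b\<^sub>m)]\<close>.\<close>

definition lincomb :: "('r, 'x) ring_scheme \<Rightarrow> ('r \<times> 'b) list \<Rightarrow> 'b \<Rightarrow> 'r" where
  "lincomb R l = foldr (\<lambda>(a, b) v c. (if c = b then a else \<zero>\<^bsub>R\<^esub>) \<oplus>\<^bsub>R\<^esub> v c) l (\<lambda>_. \<zero>\<^bsub>R\<^esub>)"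

text \<open>
  The usual step by step construction, with all stages in one type: \<open>P 0\<close> is free on the elements
  of \<open>K\<close>, and \<open>P (n + 1)\<close> is free on the formal linear combinations \<open>l\<close> of basis elements of \<open>P n\<close>
  whose value lies in the kernel of the map leaving \<open>P n\<close>; the generator \<open>Syz l\<close> is sent to that
  value. Lemmas \<open>free_res_exact\<close> and \<open>free_res_projective\<close> state that this is a projective
  resolution of \<open>K\<close>.
\<close>

datatype ('r, 'm) gen = Base (base_of: 'm) | Syz "('r \<times> ('r, 'm) gen) list"

primrec syz_val :: "('r, 'x) ring_scheme \<Rightarrow> ('r, 'm) gen \<Rightarrow> ('r, 'm) gen \<Rightarrow> 'r" where
  "syz_val R (Base x) = (\<lambda>_. \<zero>\<^bsub>R\<^esub>)"
| "syz_val R (Syz l) = lincomb R l"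

fun res_gens :: "('r, 'x) ring_scheme \<Rightarrow> ('r, 'm) module \<Rightarrow> nat \<Rightarrow> ('r, 'm) gen set" where
  "res_gens R K 0 = Base ` carrier K"
| "res_gens R K (Suc 0) = {Syz l | l. set l \<subseteq> carrier R \<times> res_gens R K 0 \<and>
     lin_ext R K base_of (lincomb R l) = \<zero>\<^bsub>K\<^esub>}"
| "res_gens R K (Suc (Suc n)) = {Syz l | l. set l \<subseteq> carrier R \<times> res_gens R K (Suc n) \<and>
     lin_ext R (free_module R (res_gens R K n)) (syz_val R) (lincomb R l) = (\<lambda>_. \<zero>\<^bsub>R\<^esub>)}"

definition free_res ::
    "('r, 'x) ring_scheme \<Rightarrow> ('r, 'm) module \<Rightarrow> nat \<Rightarrow> ('r, ('r, 'm) gen \<Rightarrow> 'r) module" where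
  "free_res R K n = free_module R (res_gens R K n)"

definition res_diff ::
    "('r, 'x) ring_scheme \<Rightarrow> ('r, 'm) module \<Rightarrow> nat \<Rightarrow> (('r, 'm) gen \<Rightarrow> 'r) \<Rightarrow> (('r, 'm) gen \<Rightarrow> 'r)" where
  "res_diff R K n = lin_ext R (free_res R K n) (syz_val R)"

definition res_aug ::
    "('r, 'x) ring_scheme \<Rightarrow> ('r, 'm) module \<Rightarrow> (('r, 'm) gen \<Rightarrow> 'r) \<Rightarrow> 'm" where
  "res_aug R K = lin_ext R K base_of"

section \<open>Ext and Tor\<close>

definition Hom_group ::
    "('r, 'x) ring_scheme \<Rightarrow> ('r, 'm) module \<Rightarrow> ('r, 'n) module \<Rightarrow> ('m \<Rightarrow> 'n) monoid" where
  "Hom_group R M N =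
     \<lparr>carrier = mod_hom R M N \<inter> extensional (carrier M),
      monoid.mult = (\<lambda>f g. \<lambda>x\<in>carrier M. f x \<oplus>\<^bsub>N\<^esub> g x),
      one = (\<lambda>x\<in>carrier M. \<zero>\<^bsub>N\<^esub>)\<rparr>"

definition subquotient :: "('g, 'x) monoid_scheme \<Rightarrow> 'g set \<Rightarrow> 'g set \<Rightarrow> 'g set monoid" where
  "subquotient G Z B = (G\<lparr>carrier := Z\<rparr>) Mod B"

text \<open>
  Cohomology of \<open>Hom(P 0, M) \<rightarrow> Hom(P 1, M) \<rightarrow> \<dots>\<close>, with \<open>P\<close> the resolution of \<open>K\<close> above. In degree
  \<open>0\<close> there is no incoming map.
\<close>

definition Ext ::
    "('r, 'x) ring_scheme \<Rightarrow> nat \<Rightarrow> ('r, 'k) module \<Rightarrow> ('r, 'm) module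
      \<Rightarrow> ((('r, 'k) gen \<Rightarrow> 'r) \<Rightarrow> 'm) set monoid" where
  "Ext R n K M =
     (let C = (\<lambda>i. Hom_group R (free_res R K i) M);
          \<delta> = (\<lambda>i f. \<lambda>x\<in>carrier (free_res R K (Suc i)). f (res_diff R K i x))
      in subquotient (C n) (kernel (C n) (C (Suc n)) (\<delta> n))
           (case n of 0 \<Rightarrow> {\<one>\<^bsub>C n\<^esub>} | Suc i \<Rightarrow> \<delta> i ` carrier (C i)))"

text \<open>
  The tensor product of a right module \<open>N\<close> and a left module \<open>P\<close>: the free abelian group on the
  pairs \<open>(x, p)\<close> modulo biadditivity and \<open>(x a, p) = (x, a p)\<close>.
\<close>

definition tensor_rels ::
    "('r, 'x) ring_scheme \<Rightarrow> ('r, 'n) module \<Rightarrow> ('r, 'p) module \<Rightarrow> (('n \<times> 'p) \<Rightarrow>\<^sub>0 int) set" where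
  "tensor_rels R N P = generate (free_Abelian_group (carrier N \<times> carrier P))
     ({frag_of (x \<oplus>\<^bsub>N\<^esub> y, p) - frag_of (x, p) - frag_of (y, p) | x y p.
         x \<in> carrier N \<and> y \<in> carrier N \<and> p \<in> carrier P} \<union>
      {frag_of (x, p \<oplus>\<^bsub>P\<^esub> q) - frag_of (x, p) - frag_of (x, q) | x p q.
         x \<in> carrier N \<and> p \<in> carrier P \<and> q \<in> carrier P} \<union>
      {frag_of (a \<odot>\<^bsub>N\<^esub> x, p) - frag_of (x, a \<odot>\<^bsub>P\<^esub> p) | a x p.
         a \<in> carrier R \<and> x \<in> carrier N \<and> p \<in> carrier P})"

definition tensor ::
    "('r, 'x) ring_scheme \<Rightarrow> ('r, 'n) module \<Rightarrow> ('r, 'p) module \<Rightarrow> (('n \<times> 'p) \<Rightarrow>\<^sub>0 int) set monoid" where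
  "tensor R N P = free_Abelian_group (carrier N \<times> carrier P) Mod tensor_rels R N P"

text \<open>
  The map \<open>N \<otimes> P \<rightarrow> N \<otimes> Q\<close> induced by a linear map \<open>d\<close> from \<open>P\<close> to \<open>Q\<close>: a coset \<open>S\<close> is mapped
  elementwise and the result is saturated to a coset.
\<close>

definition tensor_map ::
    "('r, 'x) ring_scheme \<Rightarrow> ('r, 'n) module \<Rightarrow> ('r, 'q) module \<Rightarrow> ('p \<Rightarrow> 'q)
      \<Rightarrow> (('n \<times> 'p) \<Rightarrow>\<^sub>0 int) set \<Rightarrow> (('n \<times> 'q) \<Rightarrow>\<^sub>0 int) set" where
  "tensor_map R N Q d S =
     set_mult (free_Abelian_group (carrier N \<times> carrier Q)) (tensor_rels R N Q)
       (frag_extend (\<lambda>(x, p). frag_of (x, d p)) ` S)"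

text \<open>Homology of \<open>\<dots> \<rightarrow> N \<otimes> P 1 \<rightarrow> N \<otimes> P 0\<close>. In degree \<open>0\<close> there is no outgoing map.\<close>

definition Tor ::
    "('r, 'x) ring_scheme \<Rightarrow> nat \<Rightarrow> ('r, 'n) module \<Rightarrow> ('r, 'k) module
      \<Rightarrow> (('n \<times> (('r, 'k) gen \<Rightarrow> 'r)) \<Rightarrow>\<^sub>0 int) set set monoid" where
  "Tor R n N K =
     (let T = (\<lambda>i. tensor R N (free_res R K i));
          D = (\<lambda>i. tensor_map R N (free_res R K i) (res_diff R K i))
      in subquotient (T n)
           (case n of 0 \<Rightarrow> carrier (T n) | Suc i \<Rightarrow> kernel (T n) (T i) (D i))
           (D n ` carrier (T (Suc n))))"

section \<open>Special super finitely presented modules and the dimensions\<close>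

text \<open>
  HOL has no quantification over types, so \<open>U\<close>, the \<open>F i\<close> and the special modules \<open>K\<close> range over
  the modules with carrier in a type \<open>'u\<close>, which is a parameter of the dimensions and classes
  below; no other argument is restricted. The dimension over all modules is the supremum over all
  types \<open>'u\<close>, hence a module belongs to one of the classes below in the unrestricted sense iff it
  does so for every \<open>'u\<close>. (The type \<open>(nat \<Rightarrow> 'r) set\<close> alone would do: special modules are finitely
  generated, and up to isomorphism each arises from a sequence of finitely generated modules.)
\<close>

definition syzygy ::
    "('r, 'u) module \<Rightarrow> (nat \<Rightarrow> ('r, 'u) module) \<Rightarrow> (nat \<Rightarrow> 'u \<Rightarrow> 'u) \<Rightarrow> nat \<Rightarrow> ('r, 'u) module" where
  "syzygy U F d n =
     (case n of 0 \<Rightarrow> U | Suc i \<Rightarrow> (F i)\<lparr>carrier := d i ` carrier (F (Suc i))\<rparr>)"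

text \<open>Thus \<open>syzygy U F d n\<close> is \<open>K\<^sub>n\<^sub>-\<^sub>1\<close>.\<close>

definition super_fp_seq ::
    "('r, 'x) ring_scheme \<Rightarrow> nat \<Rightarrow> ('r, 'u) module \<Rightarrow> (nat \<Rightarrow> ('r, 'u) module)
      \<Rightarrow> ('u \<Rightarrow> 'u) \<Rightarrow> (nat \<Rightarrow> 'u \<Rightarrow> 'u) \<Rightarrow> bool" where
  "super_fp_seq R n U F e d \<longleftrightarrow>
     exact_resolution R U F e d \<and> (\<forall>i. projective R (F i)) \<and> (\<forall>i\<ge>n. fin_gen R (F i))"

definition special_super_fp :: "('r, 'x) ring_scheme \<Rightarrow> nat \<Rightarrow> ('r, 'u) module \<Rightarrow> bool" where
  "special_super_fp R n K \<longleftrightarrow> (\<exists>U F e d. super_fp_seq R n U F e d \<and> K = syzygy U F d n)"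

definition wid :: "'u itself \<Rightarrow> ('r, 'x) ring_scheme \<Rightarrow> nat \<Rightarrow> ('r, 'm) module \<Rightarrow> enat" where
  "wid (_ :: 'u itself) R n M =
     Inf {enat k | k. \<forall>K :: ('r, 'u) module.
            special_super_fp R n K \<longrightarrow> trivial_group (Ext R (k + 1) K M)}"

definition wfd :: "'u itself \<Rightarrow> ('r, 'x) ring_scheme \<Rightarrow> nat \<Rightarrow> ('r, 'm) module \<Rightarrow> enat" where
  "wfd (_ :: 'u itself) R n N =
     Inf {enat k | k. \<forall>K :: ('r, 'u) module.
            special_super_fp R n K \<longrightarrow> trivial_group (Tor R (k + 1) N K)}"

definition WI :: "'u itself \<Rightarrow> ('r, 'x) ring_scheme \<Rightarrow> nat \<Rightarrow> nat \<Rightarrow> ('r, 'm) module set" where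
  "WI u R n k = {M. left_module R M \<and> wid u R n M \<le> enat k}"

definition WF :: "'u itself \<Rightarrow> ('r, 'x) ring_scheme \<Rightarrow> nat \<Rightarrow> nat \<Rightarrow> ('r, 'm) module set" where
  "WF u R n k = {N. right_module R N \<and> wfd u R n N \<le> enat k}"

section \<open>Lifting against arbitrary surjections, and exactness of the free resolution\<close>

lemma mod_homD:
  assumes "h \<in> mod_hom R M N"
  shows "\<And>x. x \<in> carrier M \<Longrightarrow> h x \<in> carrier N"
    and "\<And>x y. \<lbrakk>x \<in> carrier M; y \<in> carrier M\<rbrakk> \<Longrightarrow> h (x \<oplus>\<^bsub>M\<^esub> y) = h x \<oplus>\<^bsub>N\<^esub> h y"
    and "\<And>a x. \<lbrakk>a \<in> carrier R; x \<in> carrier M\<rbrakk> \<Longrightarrow> h (a \<odot>\<^bsub>M\<^esub> x) = a \<odot>\<^bsub>N\<^esub> h x"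
  using assms by (auto simp: mod_hom_def)

lemma mod_hom_zero:
  assumes "left_module R M" "left_module R N" "h \<in> mod_hom R M N"
  shows "h \<zero>\<^bsub>M\<^esub> = \<zero>\<^bsub>N\<^esub>"
proof -
  interpret M: left_module R M by fact
  interpret N: left_module R N by fact
  have "h \<zero>\<^bsub>M\<^esub> \<oplus>\<^bsub>N\<^esub> h \<zero>\<^bsub>M\<^esub> = h \<zero>\<^bsub>M\<^esub>"
    using mod_homD(2)[OF assms(3), of "\<zero>\<^bsub>M\<^esub>" "\<zero>\<^bsub>M\<^esub>"] by simp
  then show ?thesis
    using mod_homD(1)[OF assms(3), of "\<zero>\<^bsub>M\<^esub>"] by simp
qed

lemma (in left_module) smult_zeros [simp]:
  shows "x \<in> carrier M \<Longrightarrow> \<zero> \<odot>\<^bsub>M\<^esub> x = \<zero>\<^bsub>M\<^esub>"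
    and "a \<in> carrier R \<Longrightarrow> a \<odot>\<^bsub>M\<^esub> \<zero>\<^bsub>M\<^esub> = \<zero>\<^bsub>M\<^esub>"
proof -
  assume x: "x \<in> carrier M"
  have "\<zero> \<odot>\<^bsub>M\<^esub> x \<oplus>\<^bsub>M\<^esub> \<zero> \<odot>\<^bsub>M\<^esub> x = \<zero> \<odot>\<^bsub>M\<^esub> x"
    using smult_l_distr[of \<zero> \<zero> x] x by simp
  then show "\<zero> \<odot>\<^bsub>M\<^esub> x = \<zero>\<^bsub>M\<^esub>" using x smult_closed[of \<zero> x] by (simp del: smult_closed)
next
  assume a: "a \<in> carrier R"
  have "a \<odot>\<^bsub>M\<^esub> \<zero>\<^bsub>M\<^esub> \<oplus>\<^bsub>M\<^esub> a \<odot>\<^bsub>M\<^esub> \<zero>\<^bsub>M\<^esub> = a \<odot>\<^bsub>M\<^esub> \<zero>\<^bsub>M\<^esub>"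
    using smult_r_distr[of a "\<zero>\<^bsub>M\<^esub>" "\<zero>\<^bsub>M\<^esub>"] a by simp
  then show "a \<odot>\<^bsub>M\<^esub> \<zero>\<^bsub>M\<^esub> = \<zero>\<^bsub>M\<^esub>" using a smult_closed[of a "\<zero>\<^bsub>M\<^esub>"] by (simp del: smult_closed)
qed

lemma free_module_simps [simp]:
  "\<zero>\<^bsub>free_module R B\<^esub> = (\<lambda>_. \<zero>\<^bsub>R\<^esub>)"
  "v \<oplus>\<^bsub>free_module R B\<^esub> w = (\<lambda>b. v b \<oplus>\<^bsub>R\<^esub> w b)"
  "a \<odot>\<^bsub>free_module R B\<^esub> v = (\<lambda>b. a \<otimes>\<^bsub>R\<^esub> v b)"
  by (simp_all add: free_module_def)

lemma free_module_carrier: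
  "v \<in> carrier (free_module R B) \<longleftrightarrow>
    (\<forall>b. v b \<in> carrier R) \<and> (\<forall>b. b \<notin> B \<longrightarrow> v b = \<zero>\<^bsub>R\<^esub>) \<and> finite {b. v b \<noteq> \<zero>\<^bsub>R\<^esub>}"
  by (simp add: free_module_def)

lemma left_module_free_module:
  assumes "ring R"
  shows "left_module R (free_module R B)"
proof -
  interpret ring R by fact
  have add: "(\<lambda>b. v b \<oplus>\<^bsub>R\<^esub> w b) \<in> carrier (free_module R B)"
    if "v \<in> carrier (free_module R B)" "w \<in> carrier (free_module R B)" for v w
  proof -
    have "{b. v b \<oplus>\<^bsub>R\<^esub> w b \<noteq> \<zero>\<^bsub>R\<^esub>} \<subseteq> {b. v b \<noteq> \<zero>\<^bsub>R\<^esub>} \<union> {b. w b \<noteq> \<zero>\<^bsub>R\<^esub>}"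
      by auto
    with that show ?thesis
      unfolding free_module_carrier by (auto intro: finite_subset)
  qed
  have smult: "(\<lambda>b. a \<otimes>\<^bsub>R\<^esub> v b) \<in> carrier (free_module R B)"
    if "a \<in> carrier R" "v \<in> carrier (free_module R B)" for a v
  proof -
    have "{b. a \<otimes>\<^bsub>R\<^esub> v b \<noteq> \<zero>\<^bsub>R\<^esub>} \<subseteq> {b. v b \<noteq> \<zero>\<^bsub>R\<^esub>}"
      using that by auto
    with that show ?thesis
      unfolding free_module_carrier by (auto intro: finite_subset)
  qed
  have neg: "\<exists>w\<in>carrier (free_module R B). w \<oplus>\<^bsub>free_module R B\<^esub> v = \<zero>\<^bsub>free_module R B\<^esub>"
    if v: "v \<in> carrier (free_module R B)" for v
  proof
    have "{b. \<ominus>\<^bsub>R\<^esub> v b \<noteq> \<zero>\<^bsub>R\<^esub>} \<subseteq> {b. v b \<noteq> \<zero>\<^bsub>R\<^esub>}" by auto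
    then show "(\<lambda>b. \<ominus>\<^bsub>R\<^esub> v b) \<in> carrier (free_module R B)"
      using v unfolding free_module_carrier by (auto intro: finite_subset)
    show "(\<lambda>b. \<ominus>\<^bsub>R\<^esub> v b) \<oplus>\<^bsub>free_module R B\<^esub> v = \<zero>\<^bsub>free_module R B\<^esub>"
      using v unfolding free_module_carrier by (auto simp: l_neg)
  qed
  have "abelian_group (free_module R B)"
  proof (rule abelian_groupI)
    show "\<zero>\<^bsub>free_module R B\<^esub> \<in> carrier (free_module R B)"
      by (simp add: free_module_carrier)
  qed (use add neg in \<open>auto simp: free_module_carrier a_ac\<close>)
  then show ?thesis
    using ring_axioms smult
    by (intro left_module.intro left_module_axioms.intro)
       (auto simp: free_module_carrier l_distr r_distr m_assoc)
qed

lemma (in left_module) lin_ext_eq: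
  assumes "v \<in> carrier (free_module R B)" "g \<in> B \<rightarrow> carrier M"
    and "finite S" "{b. v b \<noteq> \<zero>} \<subseteq> S" "S \<subseteq> B"
  shows "lin_ext R M g v = (\<Oplus>\<^bsub>M\<^esub>b\<in>S. v b \<odot>\<^bsub>M\<^esub> g b)"
proof -
  have S: "\<And>b. b \<in> S \<Longrightarrow> g b \<in> carrier M" using assms by auto
  show ?thesis
    unfolding lin_ext_def using assms(1,3,4) S
    by (intro M.add.finprod_mono_neutral_cong_left) (auto simp: free_module_carrier Pi_iff)
qed

lemma (in left_module) lin_ext_hom:
  assumes g: "g \<in> B \<rightarrow> carrier M"
  shows "lin_ext R M g \<in> mod_hom R (free_module R B) M"
proof -
  have supp: "finite {b. v b \<noteq> \<zero>} \<and> {b. v b \<noteq> \<zero>} \<subseteq> B" if "v \<in> carrier (free_module R B)" for v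
    using that by (auto simp: free_module_carrier)
  have cl: "(\<lambda>b. v b \<odot>\<^bsub>M\<^esub> g b) \<in> S \<rightarrow> carrier M"
    if "v \<in> carrier (free_module R B)" "S \<subseteq> B" for v S
    using that g by (auto simp: free_module_carrier)
  interpret F: left_module R "free_module R B"
    by (rule left_module_free_module) (rule ring_axioms)
  have smult_sum: "a \<odot>\<^bsub>M\<^esub> (\<Oplus>\<^bsub>M\<^esub>b\<in>S. h b) = (\<Oplus>\<^bsub>M\<^esub>b\<in>S. a \<odot>\<^bsub>M\<^esub> h b)"
    if "a \<in> carrier R" "finite S" "h \<in> S \<rightarrow> carrier M" for a S and h :: "'d \<Rightarrow> 'm"
    using that(2,1,3) by (induction S) (auto simp: smult_r_distr Pi_iff)
  have closed: "lin_ext R M g v \<in> carrier M" if "v \<in> carrier (free_module R B)" for v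
    unfolding lin_ext_def using cl[OF that] supp[OF that] by (intro M.finsum_closed) auto
  have add: "lin_ext R M g (v \<oplus>\<^bsub>free_module R B\<^esub> w) = lin_ext R M g v \<oplus>\<^bsub>M\<^esub> lin_ext R M g w"
    if v: "v \<in> carrier (free_module R B)" and w: "w \<in> carrier (free_module R B)" for v w
  proof -
    let ?S = "{b. v b \<noteq> \<zero>} \<union> {b. w b \<noteq> \<zero>}"
    have S: "finite ?S" "?S \<subseteq> B" using supp v w by auto
    have vw: "(v \<oplus>\<^bsub>free_module R B\<^esub> w) \<in> carrier (free_module R B)" using v w by blast
    have "lin_ext R M g (v \<oplus>\<^bsub>free_module R B\<^esub> w) =
        (\<Oplus>\<^bsub>M\<^esub>b\<in>?S. (v \<oplus>\<^bsub>free_module R B\<^esub> w) b \<odot>\<^bsub>M\<^esub> g b)"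
      using S by (intro lin_ext_eq[OF vw g]) auto
    also have "\<dots> = (\<Oplus>\<^bsub>M\<^esub>b\<in>?S. v b \<odot>\<^bsub>M\<^esub> g b \<oplus>\<^bsub>M\<^esub> w b \<odot>\<^bsub>M\<^esub> g b)"
      using S v w g by (intro M.finsum_cong') (auto simp: free_module_carrier smult_l_distr Pi_iff)
    also have "\<dots> = lin_ext R M g v \<oplus>\<^bsub>M\<^esub> lin_ext R M g w"
      using S lin_ext_eq[OF v g, of ?S] lin_ext_eq[OF w g, of ?S] cl[OF v S(2)] cl[OF w S(2)]
      by (simp add: M.finsum_addf)
    finally show ?thesis .
  qed
  have smult: "lin_ext R M g (a \<odot>\<^bsub>free_module R B\<^esub> v) = a \<odot>\<^bsub>M\<^esub> lin_ext R M g v"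
    if a: "a \<in> carrier R" and v: "v \<in> carrier (free_module R B)" for a v
  proof -
    let ?S = "{b. v b \<noteq> \<zero>}"
    have S: "finite ?S" "?S \<subseteq> B" using supp v by auto
    have av: "(a \<odot>\<^bsub>free_module R B\<^esub> v) \<in> carrier (free_module R B)" using a v by blast
    have "lin_ext R M g (a \<odot>\<^bsub>free_module R B\<^esub> v) =
        (\<Oplus>\<^bsub>M\<^esub>b\<in>?S. (a \<odot>\<^bsub>free_module R B\<^esub> v) b \<odot>\<^bsub>M\<^esub> g b)"
      using S a by (intro lin_ext_eq[OF av g]) auto
    also have "\<dots> = (\<Oplus>\<^bsub>M\<^esub>b\<in>?S. a \<odot>\<^bsub>M\<^esub> (v b \<odot>\<^bsub>M\<^esub> g b))"
      using S a v g by (intro M.finsum_cong') (auto simp: free_module_carrier smult_assoc Pi_iff)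
    also have "\<dots> = a \<odot>\<^bsub>M\<^esub> lin_ext R M g v"
      unfolding lin_ext_def using smult_sum[OF a S(1) cl[OF v S(2)]] by simp
    finally show ?thesis .
  qed
  show ?thesis
    unfolding mod_hom_def using closed add smult by blast
qed

definition basis_vec :: "('r, 'x) ring_scheme \<Rightarrow> 'b \<Rightarrow> 'b \<Rightarrow> 'r" where
  "basis_vec R b = (\<lambda>c. if c = b then \<one>\<^bsub>R\<^esub> else \<zero>\<^bsub>R\<^esub>)"

lemma basis_vec_closed:
  assumes "ring R" "b \<in> B"
  shows "basis_vec R b \<in> carrier (free_module R B)"
proof -
  interpret ring R by fact
  have "{c. basis_vec R b c \<noteq> \<zero>\<^bsub>R\<^esub>} \<subseteq> {b}" by (auto simp: basis_vec_def)
  then show ?thesis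
    using assms(2) unfolding free_module_carrier by (auto simp: basis_vec_def intro: finite_subset)
qed

lemma (in left_module) lin_ext_basis_vec:
  assumes "g \<in> B \<rightarrow> carrier M" "b \<in> B"
  shows "lin_ext R M g (basis_vec R b) = g b"
proof -
  have "lin_ext R M g (basis_vec R b) = (\<Oplus>\<^bsub>M\<^esub>c\<in>{b}. basis_vec R b c \<odot>\<^bsub>M\<^esub> g c)"
    using assms by (intro lin_ext_eq[OF basis_vec_closed[OF ring_axioms assms(2)] assms(1)])
      (auto simp: basis_vec_def)
  also have "\<dots> = g b"
    using assms funcset_mem[OF assms] by (simp add: basis_vec_def)
  finally show ?thesis .
qed

lemma hom_lin_ext:
  assumes "left_module R M" "left_module R N" "h \<in> mod_hom R M N"
    and "g \<in> B \<rightarrow> carrier M" "v \<in> carrier (free_module R B)"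
  shows "h (lin_ext R M g v) = lin_ext R N (\<lambda>b. h (g b)) v"
proof -
  interpret M: left_module R M by fact
  interpret N: left_module R N by fact
  note h = mod_homD[OF assms(3)]
  have "h (\<Oplus>\<^bsub>M\<^esub>b\<in>S. v b \<odot>\<^bsub>M\<^esub> g b) = (\<Oplus>\<^bsub>N\<^esub>b\<in>S. v b \<odot>\<^bsub>N\<^esub> h (g b))"
    if "finite S" "S \<subseteq> B" for S
    using that
  proof (induction S)
    case empty
    then show ?case using mod_hom_zero[OF assms(1-3)] by simp
  next
    case (insert b S)
    have [simp]: "v c \<in> carrier R" for c using assms(5) by (auto simp: free_module_carrier)
    have [simp]: "g c \<in> carrier M" if "c \<in> insert b S" for c
      using insert.prems assms(4) that by auto
    have fM: "(\<lambda>b. v b \<odot>\<^bsub>M\<^esub> g b) \<in> S \<rightarrow> carrier M" by auto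
    have fN: "(\<lambda>b. v b \<odot>\<^bsub>N\<^esub> h (g b)) \<in> S \<rightarrow> carrier N" using h(1) by auto
    from insert fM fN show ?case
      by (simp add: h)
  qed
  moreover have "finite {b. v b \<noteq> \<zero>\<^bsub>R\<^esub>}" "{b. v b \<noteq> \<zero>\<^bsub>R\<^esub>} \<subseteq> B"
    using assms(5) by (auto simp: free_module_carrier)
  ultimately show ?thesis by (simp add: lin_ext_def)
qed

lemma free_module_lift:
  assumes "left_module R M" "left_module R N" "g \<in> mod_hom R M N" "g ` carrier M = carrier N"
    and "f \<in> mod_hom R (free_module R B) N"
  shows "\<exists>h \<in> mod_hom R (free_module R B) M. \<forall>x\<in>carrier (free_module R B). g (h x) = f x"
proof -
  interpret M: left_module R M by fact
  interpret N: left_module R N by fact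
  let ?F = "free_module R B"
  have F: "left_module R ?F" by (rule left_module_free_module) (rule M.ring_axioms)
  interpret F: left_module R ?F by fact
  have bv: "basis_vec R b \<in> carrier ?F" if "b \<in> B" for b
    using basis_vec_closed[OF M.ring_axioms that] .
  have "\<forall>b\<in>B. \<exists>m\<in>carrier M. g m = f (basis_vec R b)"
    using mod_homD(1)[OF assms(5)] bv assms(4) by (metis imageE)
  then obtain s where s: "\<And>b. b \<in> B \<Longrightarrow> s b \<in> carrier M" "\<And>b. b \<in> B \<Longrightarrow> g (s b) = f (basis_vec R b)"
    by metis
  have s': "s \<in> B \<rightarrow> carrier M" using s by auto
  have id: "lin_ext R ?F (basis_vec R) v = v" if v: "v \<in> carrier ?F" for v
  proof
    fix c
    have R: "left_module R \<lparr>carrier = carrier R, monoid.mult = undefined, one = undefined,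
        ring.zero = \<zero>\<^bsub>R\<^esub>, ring.add = add R, module.smult = mult R\<rparr>" (is "left_module R ?R")
    proof -
      have "abelian_group ?R"
        by (rule abelian_groupI) (auto simp: M.R.a_ac intro: M.R.a_inv_closed M.R.l_neg)
      then show ?thesis
        using M.ring_axioms by (intro left_module.intro left_module_axioms.intro)
          (auto simp: M.R.l_distr M.R.r_distr M.R.m_assoc)
    qed
    interpret R': left_module R ?R by fact
    have h: "(\<lambda>v. v c) \<in> mod_hom R ?F ?R"
      by (auto simp: mod_hom_def free_module_carrier)
    have "lin_ext R ?F (basis_vec R) v c = lin_ext R ?R (\<lambda>b. basis_vec R b c) v"
      using hom_lin_ext[OF F R h _ v, of "basis_vec R"] bv by auto
    also have "\<dots> = (\<Oplus>\<^bsub>?R\<^esub>b\<in>{b. v b \<noteq> \<zero>\<^bsub>R\<^esub>} \<union> (B \<inter> {c}). v b \<odot>\<^bsub>?R\<^esub> basis_vec R b c)"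
      using v by (intro R'.lin_ext_eq[where B = B]) (auto simp: free_module_carrier basis_vec_def)
    also have "\<dots> = (\<Oplus>\<^bsub>?R\<^esub>b\<in>B \<inter> {c}. v b)"
      using v by (intro R'.M.add.finprod_mono_neutral_cong_right)
        (auto simp: free_module_carrier basis_vec_def)
    also have "\<dots> = v c"
      using v by (cases "c \<in> B") (auto simp: free_module_carrier)
    finally show "lin_ext R ?F (basis_vec R) v c = v c" .
  qed
  have "g (lin_ext R M s v) = f v" if v: "v \<in> carrier ?F" for v
  proof -
    have bvB: "basis_vec R \<in> B \<rightarrow> carrier ?F" using bv by auto
    have "g (lin_ext R M s v) = lin_ext R N (\<lambda>b. g (s b)) v"
      by (rule hom_lin_ext[OF assms(1-3) s' v])
    also have "\<dots> = lin_ext R N (\<lambda>b. f (basis_vec R b)) v"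
      unfolding lin_ext_def
    proof (rule N.M.finsum_cong')
      show "(\<lambda>b. v b \<odot>\<^bsub>N\<^esub> f (basis_vec R b)) \<in> {b. v b \<noteq> \<zero>\<^bsub>R\<^esub>} \<rightarrow> carrier N"
        using v mod_homD(1)[OF assms(5) bv] unfolding free_module_carrier[of v] by blast
      fix b assume "b \<in> {b. v b \<noteq> \<zero>\<^bsub>R\<^esub>}"
      with v have "b \<in> B" by (auto simp: free_module_carrier)
      then show "v b \<odot>\<^bsub>N\<^esub> g (s b) = v b \<odot>\<^bsub>N\<^esub> f (basis_vec R b)" by (simp add: s)
    qed simp
    also have "\<dots> = f (lin_ext R ?F (basis_vec R) v)"
      by (rule hom_lin_ext[OF F assms(2,5) bvB v, symmetric])
    finally show ?thesis by (simp add: id[OF v])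
  qed
  with M.lin_ext_hom[OF s'] show ?thesis by blast
qed

lemma projective_free_module:
  assumes "ring R"
  shows "projective R (free_module R B)"
  unfolding projective_def
proof (intro conjI allI impI)
  show "left_module R (free_module R B)" by (rule left_module_free_module[OF assms])
qed (elim conjE, rule free_module_lift)

lemma mod_hom_compose:
  assumes "f \<in> mod_hom R L M" "g \<in> mod_hom R M N"
  shows "(\<lambda>x. g (f x)) \<in> mod_hom R L N"
  using assms by (auto simp: mod_hom_def Pi_iff)

lemma projective_lift:
  fixes P :: "('r, 'p) module" and M :: "('r, 'm) module" and N :: "('r, 'n) module"
  assumes P: "projective R P"
    and M: "left_module R M" and N: "left_module R N"
    and g: "g \<in> mod_hom R M N" "g ` carrier M = carrier N"
    and f: "f \<in> mod_hom R P N"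
  shows "\<exists>h \<in> mod_hom R P M. \<forall>x\<in>carrier P. g (h x) = f x"
proof -
  interpret P: left_module R P using P by (simp add: projective_def)
  let ?F = "free_module R (carrier P)"
  have F: "left_module R ?F" by (rule left_module_free_module) (rule P.ring_axioms)
  have e: "lin_ext R P id \<in> mod_hom R ?F P" by (rule P.lin_ext_hom) auto
  have surj: "lin_ext R P id ` carrier ?F = carrier P"
  proof
    show "lin_ext R P id ` carrier ?F \<subseteq> carrier P" using mod_homD(1)[OF e] by auto
    show "carrier P \<subseteq> lin_ext R P id ` carrier ?F"
    proof
      fix x assume x: "x \<in> carrier P"
      have "lin_ext R P id (basis_vec R x) = x"
        using P.lin_ext_basis_vec[of id "carrier P" x] x by simp
      with basis_vec_closed[OF P.ring_axioms x] show "x \<in> lin_ext R P id ` carrier ?F"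
        by (metis imageI)
    qed
  qed
  have id: "(\<lambda>x. x) \<in> mod_hom R P P" by (auto simp: mod_hom_def)
  obtain s where s: "s \<in> mod_hom R P ?F" "\<And>x. x \<in> carrier P \<Longrightarrow> lin_ext R P id (s x) = x"
  proof -
    have "\<exists>s \<in> mod_hom R P ?F. \<forall>x\<in>carrier P. lin_ext R P id (s x) = (\<lambda>x. x) x"
      using P[unfolded projective_def, THEN conjunct2, rule_format, of ?F P "lin_ext R P id" "\<lambda>x. x"]
        F P.left_module_axioms e surj id by simp
    then show ?thesis using that by auto
  qed
  obtain k where k: "k \<in> mod_hom R ?F M"
    "\<And>x. x \<in> carrier ?F \<Longrightarrow> g (k x) = f (lin_ext R P id x)"
    using free_module_lift[OF M N g mod_hom_compose[OF e f]] by blast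
  have "g (k (s x)) = f x" if "x \<in> carrier P" for x
    using s(2) k(2) mod_homD(1)[OF s(1)] that by simp
  then show ?thesis
    by (intro bexI[where x = "\<lambda>x. k (s x)"] ballI mod_hom_compose[OF s(1) k(1)])
qed

lemma lincomb_simps [simp]:
  "lincomb R [] = (\<lambda>_. \<zero>\<^bsub>R\<^esub>)"
  "lincomb R ((a, b) # l) = (\<lambda>c. (if c = b then a else \<zero>\<^bsub>R\<^esub>) \<oplus>\<^bsub>R\<^esub> lincomb R l c)"
  by (simp_all add: lincomb_def)

lemma lincomb_closed:
  assumes "ring R" "set l \<subseteq> carrier R \<times> B"
  shows "lincomb R l \<in> carrier (free_module R B)"
  using assms(2)
proof (induction l)
  case Nil
  interpret ring R by fact
  show ?case by (simp add: free_module_carrier)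
next
  case (Cons p l)
  interpret ring R by fact
  obtain a b where p: "p = (a, b)" by fastforce
  have IH: "lincomb R l \<in> carrier (free_module R B)" using Cons by simp
  have "{c. lincomb R (p # l) c \<noteq> \<zero>\<^bsub>R\<^esub>} \<subseteq> insert b {c. lincomb R l c \<noteq> \<zero>\<^bsub>R\<^esub>}"
    by (auto simp: p)
  then show ?case
    using IH Cons.prems finite_subset[of "{c. lincomb R (p # l) c \<noteq> \<zero>\<^bsub>R\<^esub>}"]
    unfolding free_module_carrier by (simp add: p)
qed

lemma lincomb_surj:
  assumes "ring R" "v \<in> carrier (free_module R B)"
  obtains l where "set l \<subseteq> carrier R \<times> B" "lincomb R l = v"
proof -
  interpret ring R by fact
  have v: "\<And>b. v b \<in> carrier R" "\<And>b. b \<notin> B \<Longrightarrow> v b = \<zero>\<^bsub>R\<^esub>" "finite {b. v b \<noteq> \<zero>\<^bsub>R\<^esub>}"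
    using assms(2) by (auto simp: free_module_carrier)
  obtain bs where bs: "set bs = {b. v b \<noteq> \<zero>\<^bsub>R\<^esub>}" "distinct bs"
    using finite_distinct_list[OF v(3)] by blast
  have *: "lincomb R (map (\<lambda>b. (v b, b)) xs) c = (if c \<in> set xs then v c else \<zero>\<^bsub>R\<^esub>)"
    if "distinct xs" for xs c
    using that by (induction xs) (auto simp: v)
  have "lincomb R (map (\<lambda>b. (v b, b)) bs) = v"
    using *[OF bs(2)] bs(1) by auto
  moreover have "set (map (\<lambda>b. (v b, b)) bs) \<subseteq> carrier R \<times> B"
    using bs(1) v by auto
  ultimately show ?thesis using that by blast
qed

lemma left_module_free_res: "ring R \<Longrightarrow> left_module R (free_res R K n)"
  by (simp add: free_res_def left_module_free_module)

lemma free_res_projective: "ring R \<Longrightarrow> projective R (free_res R K n)"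
  by (simp add: free_res_def projective_free_module)

lemma lin_ext_zero:
  assumes "left_module R M" "\<And>b. b \<in> B \<Longrightarrow> g b = \<zero>\<^bsub>M\<^esub>" "v \<in> carrier (free_module R B)"
  shows "lin_ext R M g v = \<zero>\<^bsub>M\<^esub>"
proof -
  interpret M: left_module R M by fact
  have "lin_ext R M g v = (\<Oplus>\<^bsub>M\<^esub>b\<in>{b. v b \<noteq> \<zero>\<^bsub>R\<^esub>}. \<zero>\<^bsub>M\<^esub>)"
    unfolding lin_ext_def
  proof (rule M.M.finsum_cong')
    fix b assume "b \<in> {b. v b \<noteq> \<zero>\<^bsub>R\<^esub>}"
    with assms(3) have "b \<in> B" "v b \<in> carrier R" by (auto simp: free_module_carrier)
    then show "v b \<odot>\<^bsub>M\<^esub> g b = \<zero>\<^bsub>M\<^esub>" using assms(2) by simp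
  qed auto
  then show ?thesis by simp
qed

text \<open>One step: generators indexed by the formal combinations with value in a kernel.\<close>

lemma syz_step:
  assumes "left_module R N" and h: "h \<in> mod_hom R (free_module R B) N"
    and B': "B' = {Syz l | l. set l \<subseteq> carrier R \<times> B \<and> h (lincomb R l) = \<zero>\<^bsub>N\<^esub>}"
  shows "lin_ext R (free_module R B) (syz_val R) \<in> mod_hom R (free_module R B') (free_module R B)"
    and "lin_ext R (free_module R B) (syz_val R) ` carrier (free_module R B')
      = a_kernel (free_module R B) N h"
proof -
  interpret N: left_module R N by fact
  have F: "left_module R (free_module R B)"
    by (rule left_module_free_module) (rule N.ring_axioms)
  interpret F: left_module R "free_module R B" by fact
  let ?d = "lin_ext R (free_module R B) (syz_val R)"
  have g: "syz_val R \<in> B' \<rightarrow> carrier (free_module R B)"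
    using lincomb_closed[OF N.ring_axioms] by (auto simp: B')
  show d: "?d \<in> mod_hom R (free_module R B') (free_module R B)"
    by (rule F.lin_ext_hom[OF g])
  show "?d ` carrier (free_module R B') = a_kernel (free_module R B) N h"
  proof (intro equalityI subsetI)
    fix y assume "y \<in> ?d ` carrier (free_module R B')"
    then obtain v where v: "v \<in> carrier (free_module R B')" "y = ?d v" by blast
    have "h (?d v) = lin_ext R N (\<lambda>b. h (syz_val R b)) v"
      by (rule hom_lin_ext[OF F assms(1) h g v(1)])
    also have "\<dots> = \<zero>\<^bsub>N\<^esub>"
      by (rule lin_ext_zero[OF assms(1) _ v(1)]) (auto simp: B')
    finally show "y \<in> a_kernel (free_module R B) N h"
      using mod_homD(1)[OF d v(1)] v(2) by (simp add: a_kernel_def')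
  next
    fix y assume "y \<in> a_kernel (free_module R B) N h"
    then have y: "y \<in> carrier (free_module R B)" "h y = \<zero>\<^bsub>N\<^esub>" by (auto simp: a_kernel_def')
    obtain l where l: "set l \<subseteq> carrier R \<times> B" "lincomb R l = y"
      using lincomb_surj[OF N.ring_axioms y(1)] .
    have mem: "Syz l \<in> B'" using l y by (auto simp: B')
    have "?d (basis_vec R (Syz l)) = y"
      using F.lin_ext_basis_vec[OF g mem] l by simp
    with basis_vec_closed[OF N.ring_axioms mem] show "y \<in> ?d ` carrier (free_module R B')"
      by (metis imageI)
  qed
qed

lemma free_res_exact:
  assumes K: "left_module R K"
  shows "exact_resolution R K (free_res R K) (res_aug R K) (res_diff R K)"
proof -
  interpret K: left_module R K by fact
  have F: "left_module R (free_res R K n)" for n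
    by (rule left_module_free_res) (rule K.ring_axioms)
  have g: "base_of \<in> res_gens R K 0 \<rightarrow> carrier K" by auto
  have e: "res_aug R K \<in> mod_hom R (free_res R K 0) K"
    unfolding res_aug_def free_res_def by (rule K.lin_ext_hom[OF g])
  have surj: "res_aug R K ` carrier (free_res R K 0) = carrier K"
  proof (intro equalityI subsetI)
    fix x assume "x \<in> carrier K"
    then have x: "Base x \<in> res_gens R K 0" by simp
    have "res_aug R K (basis_vec R (Base x)) = x"
      unfolding res_aug_def using K.lin_ext_basis_vec[OF g x] by simp
    with basis_vec_closed[OF K.ring_axioms x] show "x \<in> res_aug R K ` carrier (free_res R K 0)"
      unfolding free_res_def by (metis imageI)
  qed (use mod_homD(1)[OF e] in auto)
  note s0 = syz_step[OF K e[unfolded free_res_def], of "res_gens R K (Suc 0)",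
      folded free_res_def, folded res_diff_def]
  have d0: "res_diff R K 0 \<in> mod_hom R (free_res R K (Suc 0)) (free_res R K 0)"
      "res_diff R K 0 ` carrier (free_res R K (Suc 0)) = a_kernel (free_res R K 0) K (res_aug R K)"
    using s0 by (simp_all add: res_aug_def)
  have step: "res_diff R K (Suc n) \<in> mod_hom R (free_res R K (Suc (Suc n))) (free_res R K (Suc n))"
      "res_diff R K (Suc n) ` carrier (free_res R K (Suc (Suc n)))
        = a_kernel (free_res R K (Suc n)) (free_res R K n) (res_diff R K n)"
    if d: "res_diff R K n \<in> mod_hom R (free_res R K (Suc n)) (free_res R K n)" for n
    using syz_step[OF F[of n] d[unfolded free_res_def[of R K "Suc n"]], of "res_gens R K (Suc (Suc n))",
      folded free_res_def, folded res_diff_def]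
    by (simp_all add: res_diff_def free_res_def)
  have d: "res_diff R K n \<in> mod_hom R (free_res R K (Suc n)) (free_res R K n)" for n
    by (induction n) (use d0 step in auto)
  show ?thesis
    unfolding exact_resolution_def using K F e surj d d0 step[OF d] by blast
qed

end

theory Submission
  imports Defs
begin

text \<open>
  Membership of \<open>M\<close> in \<open>WI\<close> with bound \<open>k\<close> says that for some \<open>j \<le> k\<close> the group
  \<open>Ext\<^sup>j\<^sup>+\<^sup>1(K, M)\<close> vanishes for all special modules \<open>K\<close>. A special module \<open>K\<close> is a quotient of a
  projective module by another special module \<open>K'\<close> (\<open>special_super_fp_cover\<close>), so dimension
  shifting from \<open>K'\<close> to \<open>K\<close> turns vanishing in degree \<open>j + 1\<close> into vanishing in degree \<open>j + 2\<close>
  (\<open>Ext_shift\<close>). Hence the vanishing of \<open>Ext\<^sup>k\<^sup>+\<^sup>1\<close> alone characterises the class (\<open>WI_iff\<close>), and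
  \<open>Ext\<^sup>k\<^sup>+\<^sup>2\<close> vanishes as well. The first claim now follows from the exactness of
  \<open>Ext\<^sup>k\<^sup>+\<^sup>1(K, B) \<rightarrow> Ext\<^sup>k\<^sup>+\<^sup>1(K, C) \<rightarrow> Ext\<^sup>k\<^sup>+\<^sup>2(K, A)\<close> (\<open>Ext_middle_exact\<close>), in which the outer
  groups are zero. The second claim is dual, by \<open>Tor_shift\<close>, \<open>WF_iff\<close> and the exactness of
  \<open>Tor\<^sub>k\<^sub>+\<^sub>2(C, K) \<rightarrow> Tor\<^sub>k\<^sub>+\<^sub>1(A, K) \<rightarrow> Tor\<^sub>k\<^sub>+\<^sub>1(B, K)\<close> (\<open>Tor_middle_exact\<close>).
  
  Ext and Tor are defined by one particular free resolution. Dimension shifting therefore needs the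
  comparison of two resolutions of \<open>K\<close>: the given one, and the one of \<open>K'\<close> with the projective
  module that covers \<open>K\<close> in front. Lemma \<open>syzygy_comparison\<close> provides the chain maps and the
  homotopy once for both functors.
  
  For Tor, elements of tensor products are represented in the free abelian group on pairs, and all
  maps are computed there modulo the tensor relations. The long exact sequence needs that tensoring
  with the free terms of the resolution is exact. This is seen from coordinates with respect to
  the basis (\<open>coord_normal_form\<close>, \<open>coord_natural\<close>), which reduce injectivity and exactness to
  the given sequence of right modules (\<open>free_tensor_injective\<close>, \<open>free_tensor_exact\<close>).
\<close>

section \<open>Linear maps and submodules\<close>

lemma (in left_module) smult_neg:
  assumes "a \<in> carrier R" "x \<in> carrier M"
  shows "a \<odot>\<^bsub>M\<^esub> (\<ominus>\<^bsub>M\<^esub> x) = \<ominus>\<^bsub>M\<^esub> (a \<odot>\<^bsub>M\<^esub> x)"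
proof -
  have "a \<odot>\<^bsub>M\<^esub> (\<ominus>\<^bsub>M\<^esub> x) \<oplus>\<^bsub>M\<^esub> a \<odot>\<^bsub>M\<^esub> x = \<zero>\<^bsub>M\<^esub>"
    using assms smult_r_distr[of a "\<ominus>\<^bsub>M\<^esub> x" x] by (simp add: M.l_neg)
  then show ?thesis
    using assms by (intro M.minus_equality[symmetric]) auto
qed

lemma mod_hom_add:
  assumes "left_module R N" "f \<in> mod_hom R M N" "g \<in> mod_hom R M N"
  shows "(\<lambda>x. f x \<oplus>\<^bsub>N\<^esub> g x) \<in> mod_hom R M N"
proof -
  interpret N: left_module R N by fact
  show ?thesis
    using assms(2,3) by (auto simp: mod_hom_def Pi_iff N.smult_r_distr N.M.a_ac)
qed

lemma mod_hom_neg: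
  assumes "left_module R N" "f \<in> mod_hom R M N"
  shows "(\<lambda>x. \<ominus>\<^bsub>N\<^esub> f x) \<in> mod_hom R M N"
proof -
  interpret N: left_module R N by fact
  show ?thesis
    using assms(2) by (auto simp: mod_hom_def Pi_iff N.smult_neg N.M.minus_add)
qed

lemma mod_hom_diff:
  assumes "left_module R N" "f \<in> mod_hom R M N" "g \<in> mod_hom R M N"
  shows "(\<lambda>x. f x \<ominus>\<^bsub>N\<^esub> g x) \<in> mod_hom R M N"
  unfolding a_minus_def by (intro mod_hom_add mod_hom_neg assms)

lemma mod_hom_id: "(\<lambda>x. x) \<in> mod_hom R M M"
  by (auto simp: mod_hom_def)

lemma mod_hom_minus:
  assumes "left_module R M" "left_module R N" "h \<in> mod_hom R M N" "x \<in> carrier M" "y \<in> carrier M"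
  shows "h (x \<ominus>\<^bsub>M\<^esub> y) = h x \<ominus>\<^bsub>N\<^esub> h y"
proof -
  interpret M: left_module R M by fact
  interpret N: left_module R N by fact
  have "h (x \<ominus>\<^bsub>M\<^esub> y) \<oplus>\<^bsub>N\<^esub> h y = h x"
    using mod_homD(2)[OF assms(3), of "x \<ominus>\<^bsub>M\<^esub> y" y] assms(4,5)
    by (simp add: M.M.minus_eq M.M.a_assoc M.M.l_neg)
  then have "h x \<ominus>\<^bsub>N\<^esub> h y = h (x \<ominus>\<^bsub>M\<^esub> y) \<oplus>\<^bsub>N\<^esub> h y \<ominus>\<^bsub>N\<^esub> h y"
    by simp
  also have "\<dots> = h (x \<ominus>\<^bsub>M\<^esub> y)"
    using mod_homD(1)[OF assms(3)] assms(4,5) by (simp add: N.M.minus_eq N.M.a_assoc N.M.r_neg)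
  finally show ?thesis ..
qed

lemma left_module_restrict:
  assumes "left_module R M" and S: "S \<subseteq> carrier M" "\<zero>\<^bsub>M\<^esub> \<in> S"
    and add: "\<And>x y. x \<in> S \<Longrightarrow> y \<in> S \<Longrightarrow> x \<oplus>\<^bsub>M\<^esub> y \<in> S"
    and smult: "\<And>a x. a \<in> carrier R \<Longrightarrow> x \<in> S \<Longrightarrow> a \<odot>\<^bsub>M\<^esub> x \<in> S"
  shows "left_module R (M\<lparr>carrier := S\<rparr>)"
proof -
  interpret M: left_module R M by fact
  have neg: "\<exists>y\<in>S. y \<oplus>\<^bsub>M\<^esub> x = \<zero>\<^bsub>M\<^esub>" if x: "x \<in> S" for x
  proof
    have xM: "x \<in> carrier M" using x S by blast
    \<comment> \<open>Additive inverses are multiples by \<open>-1\<close>.\<close>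
    show "\<ominus>\<^bsub>R\<^esub> \<one>\<^bsub>R\<^esub> \<odot>\<^bsub>M\<^esub> x \<in> S" using x by (intro smult) auto
    have "(\<ominus>\<^bsub>R\<^esub> \<one>\<^bsub>R\<^esub> \<oplus>\<^bsub>R\<^esub> \<one>\<^bsub>R\<^esub>) \<odot>\<^bsub>M\<^esub> x = \<ominus>\<^bsub>R\<^esub> \<one>\<^bsub>R\<^esub> \<odot>\<^bsub>M\<^esub> x \<oplus>\<^bsub>M\<^esub> x"
      using xM by (subst M.smult_l_distr) auto
    then show "\<ominus>\<^bsub>R\<^esub> \<one>\<^bsub>R\<^esub> \<odot>\<^bsub>M\<^esub> x \<oplus>\<^bsub>M\<^esub> x = \<zero>\<^bsub>M\<^esub>"
      using xM by (simp add: M.R.l_neg)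
  qed
  have "abelian_group (M\<lparr>carrier := S\<rparr>)"
    by (rule abelian_groupI) (use S add neg in \<open>auto simp: M.M.a_ac subset_iff\<close>)
  then show ?thesis
    using S smult M.ring_axioms
    by (intro left_module.intro left_module_axioms.intro)
       (auto simp: subset_iff M.smult_l_distr M.smult_r_distr M.smult_assoc)
qed

lemma left_module_image:
  assumes "left_module R M" "left_module R N" "h \<in> mod_hom R M N"
  shows "left_module R (N\<lparr>carrier := h ` carrier M\<rparr>)"
proof -
  interpret M: left_module R M by fact
  note h = mod_homD[OF assms(3)]
  show ?thesis
  proof (rule left_module_restrict[OF assms(2)])
    show "\<zero>\<^bsub>N\<^esub> \<in> h ` carrier M" using mod_hom_zero[OF assms] by (metis M.M.zero_closed imageI)
    show "x \<oplus>\<^bsub>N\<^esub> y \<in> h ` carrier M" if "x \<in> h ` carrier M" "y \<in> h ` carrier M" for x y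
      using that by (auto simp flip: h(2))
    show "a \<odot>\<^bsub>N\<^esub> x \<in> h ` carrier M" if "a \<in> carrier R" "x \<in> h ` carrier M" for a x
      using that by (auto simp flip: h(3))
  qed (use h in auto)
qed

lemma mod_hom_restrict_codomain:
  assumes "f \<in> mod_hom R M N" "f ` carrier M \<subseteq> S"
  shows "f \<in> mod_hom R M (N\<lparr>carrier := S\<rparr>)"
  using assms by (auto simp: mod_hom_def)

text \<open>
  Lifting along a map that need not be surjective, as long as the image of the map to be lifted is
  reached. Stating the hypothesis through images rather than kernels avoids naming the module that
  follows \<open>Y\<close> in an exact sequence, which may live in another type.
\<close>

lemma projective_lift_image:
  assumes "projective R P" "left_module R X" "left_module R Y"
    and d: "d \<in> mod_hom R X Y" and f: "f \<in> mod_hom R P Y" "f ` carrier P \<subseteq> d ` carrier X"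
  obtains h where "h \<in> mod_hom R P X" "\<And>x. x \<in> carrier P \<Longrightarrow> d (h x) = f x"
proof -
  have "\<exists>h\<in>mod_hom R P X. \<forall>x\<in>carrier P. d (h x) = f x"
    using assms(1,2) left_module_image[OF assms(2,3) d]
    by (rule projective_lift) (auto intro!: mod_hom_restrict_codomain d f(1) f(2))
  then show ?thesis using that by blast
qed

section \<open>Comparison of resolutions\<close>

lemma exact_resolutionD:
  assumes "exact_resolution R U F e d"
  shows "left_module R U" "\<And>i. left_module R (F i)"
    "e \<in> mod_hom R (F 0) U" "\<And>i. d i \<in> mod_hom R (F (Suc i)) (F i)"
    "e ` carrier (F 0) = carrier U"
    "d 0 ` carrier (F (Suc 0)) = {x \<in> carrier (F 0). e x = \<zero>\<^bsub>U\<^esub>}"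
    "\<And>i. d (Suc i) ` carrier (F (Suc (Suc i))) = {x \<in> carrier (F (Suc i)). d i x = \<zero>\<^bsub>F i\<^esub>}"
  using assms by (auto simp: exact_resolution_def a_kernel_def')

lemma exact_resolution_dd:
  assumes "exact_resolution R U F e d"
  shows "x \<in> carrier (F (Suc 0)) \<Longrightarrow> e (d 0 x) = \<zero>\<^bsub>U\<^esub>"
    "x \<in> carrier (F (Suc (Suc i))) \<Longrightarrow> d i (d (Suc i) x) = \<zero>\<^bsub>F i\<^esub>"
  using exact_resolutionD(6,7)[OF assms] by blast+

text \<open>
  Dropping the first term resolves the first syzygy, realised inside the old first term. All types
  stay the same, which is what makes special modules closed under syzygies within one type.
\<close>

lemma exact_resolution_shift:
  assumes "exact_resolution R U F e d"
  shows "exact_resolution R ((F 0)\<lparr>carrier := d 0 ` carrier (F (Suc 0))\<rparr>)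
    (\<lambda>i. F (Suc i)) (d 0) (\<lambda>i. d (Suc i))"
proof -
  note F = exact_resolutionD[OF assms]
  show ?thesis
    unfolding exact_resolution_def
    using F left_module_image[OF F(2) F(2) F(4), of 0] mod_hom_restrict_codomain[OF F(4) subset_refl, of 0]
    by (simp add: a_kernel_def')
qed

text \<open>
  The comparison theorem: a map in degree \<open>0\<close> extends to a chain map from a complex of projectives
  into an exact sequence. The condition on \<open>f\<close> replaces the usual commuting square with a map of
  the resolved modules, so that the lemma also applies when the source complex is a resolution with
  its first term removed.
\<close>

lemma chain_map_lift:
  assumes Q: "\<And>i. projective R (Q i)" "\<And>i. b i \<in> mod_hom R (Q (Suc i)) (Q i)"
    and bb: "\<And>i x. x \<in> carrier (Q (Suc (Suc i))) \<Longrightarrow> b i (b (Suc i) x) = \<zero>\<^bsub>Q i\<^esub>"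
    and res: "exact_resolution R U F e d"
    and f: "f \<in> mod_hom R (Q 0) (F 0)" "\<And>x. x \<in> carrier (Q (Suc 0)) \<Longrightarrow> e (f (b 0 x)) = \<zero>\<^bsub>U\<^esub>"
  obtains \<phi> where "\<phi> 0 = f" "\<And>i. \<phi> i \<in> mod_hom R (Q i) (F i)"
    "\<And>i x. x \<in> carrier (Q (Suc i)) \<Longrightarrow> d i (\<phi> (Suc i) x) = \<phi> i (b i x)"
proof -
  note F = exact_resolutionD[OF res]
  have mQ: "left_module R (Q i)" for i using Q(1) by (simp add: projective_def)
  \<comment> \<open>The third conjunct is the liftability condition for the next step, stated uniformly in all degrees.\<close>
  let ?P = "\<lambda>i g. g \<in> mod_hom R (Q i) (F i) \<and> (i = 0 \<longrightarrow> g = f) \<and>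
    (\<forall>x\<in>carrier (Q (Suc i)). g (b i x) \<in> d i ` carrier (F (Suc i)))"
  let ?C = "\<lambda>i g h. \<forall>x\<in>carrier (Q (Suc i)). d i (h x) = g (b i x)"
  have "\<exists>\<phi>. \<forall>i. ?P i (\<phi> i) \<and> ?C i (\<phi> i) (\<phi> (Suc i))"
  proof (rule dependent_nat_choice)
    have "f (b 0 x) \<in> d 0 ` carrier (F (Suc 0))" if "x \<in> carrier (Q (Suc 0))" for x
      using that f(2) mod_homD(1)[OF f(1)] mod_homD(1)[OF Q(2)] unfolding F(6) by simp
    then show "\<exists>g. ?P 0 g" using f(1) by blast
  next
    fix g i assume g: "?P i g"
    then have gh: "g \<in> mod_hom R (Q i) (F i)" by blast
    obtain h where h: "h \<in> mod_hom R (Q (Suc i)) (F (Suc i))"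
      "\<And>x. x \<in> carrier (Q (Suc i)) \<Longrightarrow> d i (h x) = g (b i x)"
      by (rule projective_lift_image[OF Q(1) F(2) F(2) F(4) mod_hom_compose[OF Q(2) gh]])
         (use g in auto)
    have "h (b (Suc i) x) \<in> d (Suc i) ` carrier (F (Suc (Suc i)))"
      if x: "x \<in> carrier (Q (Suc (Suc i)))" for x
    proof -
      have bx: "b (Suc i) x \<in> carrier (Q (Suc i))" by (rule mod_homD(1)[OF Q(2) x])
      have "d i (h (b (Suc i) x)) = \<zero>\<^bsub>F i\<^esub>"
        using h(2)[OF bx] bb[OF x] mod_hom_zero[OF mQ F(2) gh] by simp
      then show ?thesis using mod_homD(1)[OF h(1) bx] unfolding F(7) by simp
    qed
    then show "\<exists>h. ?P (Suc i) h \<and> ?C i g h" using h by blast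
  qed
  then show ?thesis using that by blast
qed

text \<open>
  A chain map into an exact sequence that induces zero on the resolved module is null homotopic:
  by induction, \<open>\<theta>\<^sub>i\<^sub>+\<^sub>1 - h\<^sub>i b\<^sub>i\<close> lands in the kernel of \<open>d\<^sub>i\<close>, hence lifts along \<open>d\<^sub>i\<^sub>+\<^sub>1\<close>.
\<close>

lemma null_homotopy:
  assumes Q: "\<And>i. projective R (Q i)" "\<And>i. b i \<in> mod_hom R (Q (Suc i)) (Q i)"
    and bb: "\<And>i x. x \<in> carrier (Q (Suc (Suc i))) \<Longrightarrow> b i (b (Suc i) x) = \<zero>\<^bsub>Q i\<^esub>"
    and res: "exact_resolution R U F e d"
    and \<theta>: "\<And>i. \<theta> i \<in> mod_hom R (Q i) (F i)"
    and chain: "\<And>i x. x \<in> carrier (Q (Suc i)) \<Longrightarrow> d i (\<theta> (Suc i) x) = \<theta> i (b i x)"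
    and zero: "\<And>x. x \<in> carrier (Q 0) \<Longrightarrow> e (\<theta> 0 x) = \<zero>\<^bsub>U\<^esub>"
  obtains h where "\<And>i. h i \<in> mod_hom R (Q i) (F (Suc i))"
    "\<And>x. x \<in> carrier (Q 0) \<Longrightarrow> d 0 (h 0 x) = \<theta> 0 x"
    "\<And>i x. x \<in> carrier (Q (Suc i)) \<Longrightarrow> d (Suc i) (h (Suc i) x) \<oplus>\<^bsub>F (Suc i)\<^esub> h i (b i x) = \<theta> (Suc i) x"
proof -
  note F = exact_resolutionD[OF res]
  have mQ: "left_module R (Q i)" for i using Q(1) by (simp add: projective_def)
  let ?P = "\<lambda>i h. h \<in> mod_hom R (Q i) (F (Suc i)) \<and>
    (i = 0 \<longrightarrow> (\<forall>x\<in>carrier (Q 0). d 0 (h x) = \<theta> 0 x)) \<and>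
    (\<forall>x\<in>carrier (Q (Suc i)). d i (h (b i x)) = \<theta> i (b i x))"
  let ?C = "\<lambda>i h h'. \<forall>x\<in>carrier (Q (Suc i)).
    d (Suc i) (h' x) \<oplus>\<^bsub>F (Suc i)\<^esub> h (b i x) = \<theta> (Suc i) x"
  have "\<exists>h. \<forall>i. ?P i (h i) \<and> ?C i (h i) (h (Suc i))"
  proof (rule dependent_nat_choice)
    have "\<theta> 0 ` carrier (Q 0) \<subseteq> d 0 ` carrier (F (Suc 0))"
      unfolding F(6) using zero mod_homD(1)[OF \<theta>] by auto
    then obtain h where h: "h \<in> mod_hom R (Q 0) (F (Suc 0))"
      "\<And>x. x \<in> carrier (Q 0) \<Longrightarrow> d 0 (h x) = \<theta> 0 x"
      using projective_lift_image[OF Q(1) F(2) F(2) F(4) \<theta>] by blast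
    then show "\<exists>h. ?P 0 h" using mod_homD(1)[OF Q(2)] by auto
  next
    fix h i assume "?P i h"
    then have h: "h \<in> mod_hom R (Q i) (F (Suc i))"
      and dh: "\<And>x. x \<in> carrier (Q (Suc i)) \<Longrightarrow> d i (h (b i x)) = \<theta> i (b i x)" by blast+
    interpret Fi: left_module R "F i" by (rule F(2))
    interpret Fs: left_module R "F (Suc i)" by (rule F(2))
    have hb: "(\<lambda>x. h (b i x)) \<in> mod_hom R (Q (Suc i)) (F (Suc i))"
      by (rule mod_hom_compose[OF Q(2) h])
    let ?g = "\<lambda>x. \<theta> (Suc i) x \<ominus>\<^bsub>F (Suc i)\<^esub> h (b i x)"
    have g: "?g \<in> mod_hom R (Q (Suc i)) (F (Suc i))"
      by (rule mod_hom_diff[OF F(2) \<theta> hb])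
    have "d i (?g x) = \<zero>\<^bsub>F i\<^esub>" if x: "x \<in> carrier (Q (Suc i))" for x
    proof -
      have "d i (?g x) = d i (\<theta> (Suc i) x) \<ominus>\<^bsub>F i\<^esub> d i (h (b i x))"
        by (rule mod_hom_minus[OF F(2) F(2) F(4) mod_homD(1)[OF \<theta> x] mod_homD(1)[OF hb x]])
      also have "\<dots> = \<zero>\<^bsub>F i\<^esub>"
        using chain[OF x] dh[OF x] mod_homD(1)[OF \<theta> mod_homD(1)[OF Q(2) x]]
        by (simp add: Fi.M.minus_eq Fi.M.r_neg)
      finally show ?thesis .
    qed
    then have "?g ` carrier (Q (Suc i)) \<subseteq> d (Suc i) ` carrier (F (Suc (Suc i)))"
      unfolding F(7) using mod_homD(1)[OF g] by auto
    then obtain h' where h': "h' \<in> mod_hom R (Q (Suc i)) (F (Suc (Suc i)))"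
      "\<And>x. x \<in> carrier (Q (Suc i)) \<Longrightarrow> d (Suc i) (h' x) = ?g x"
      using projective_lift_image[OF Q(1) F(2) F(2) F(4) g] by blast
    have C: "?C i h h'"
    proof
      fix x assume x: "x \<in> carrier (Q (Suc i))"
      show "d (Suc i) (h' x) \<oplus>\<^bsub>F (Suc i)\<^esub> h (b i x) = \<theta> (Suc i) x"
        using mod_homD(1)[OF \<theta> x] mod_homD(1)[OF hb x]
        by (simp add: h'(2)[OF x] Fs.M.minus_eq Fs.M.a_assoc Fs.M.l_neg)
    qed
    have "d (Suc i) (h' (b (Suc i) x)) = \<theta> (Suc i) (b (Suc i) x)"
      if x: "x \<in> carrier (Q (Suc (Suc i)))" for x
    proof -
      have bx: "b (Suc i) x \<in> carrier (Q (Suc i))" by (rule mod_homD(1)[OF Q(2) x])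
      show ?thesis
        using h'(2)[OF bx] bb[OF x] mod_hom_zero[OF mQ F(2) h] mod_homD(1)[OF \<theta> bx]
        by (simp add: Fs.M.minus_eq)
    qed
    then show "\<exists>h'. ?P (Suc i) h' \<and> ?C i h h'" using h' C by blast
  qed
  then obtain h where "\<forall>i. ?P i (h i) \<and> ?C i (h i) (h (Suc i))" by blast
  then show ?thesis by (intro that[of h]) blast+
qed

lemma free_res_maps:
  assumes "left_module R K"
  shows "left_module R (free_res R K i)" "projective R (free_res R K i)"
    "res_diff R K i \<in> mod_hom R (free_res R K (Suc i)) (free_res R K i)"
    "res_aug R K \<in> mod_hom R (free_res R K 0) K"
proof -
  interpret K: left_module R K by fact
  show "left_module R (free_res R K i)" "projective R (free_res R K i)"
    using left_module_free_res free_res_projective K.ring_axioms by blast+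
qed (use exact_resolutionD(3,4)[OF free_res_exact[OF assms]] in auto)

text \<open>
  Let \<open>0 \<rightarrow> K' \<rightarrow> F \<rightarrow> K \<rightarrow> 0\<close> be exact with \<open>F\<close> projective. Splicing \<open>F\<close> in front of the resolution
  \<open>P\<close> of \<open>K'\<close> gives a second projective resolution of \<open>K\<close>, homotopy equivalent to the resolution \<open>Q\<close>.
  Half of the equivalence is recorded here in positive degrees of \<open>Q\<close>: chain maps
  \<open>\<phi>\<^sub>i : Q\<^sub>i\<^sub>+\<^sub>1 \<rightarrow> P\<^sub>i\<close> and \<open>\<psi>\<^sub>i : P\<^sub>i \<rightarrow> Q\<^sub>i\<^sub>+\<^sub>1\<close> with \<open>\<psi> \<phi>\<close> homotopic to the identity. This is all
  that is needed to carry the vanishing of a derived functor from \<open>K'\<close> to \<open>K\<close>. The components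
  \<open>s : Q\<^sub>0 \<rightarrow> F\<close> and \<open>t : F \<rightarrow> Q\<^sub>0\<close> in degree \<open>0\<close> are treated separately, because \<open>F\<close> and the
  \<open>P\<^sub>i\<close> do not share a type.
\<close>

lemma syzygy_comparison:
  fixes K F :: "('r, 'u) module"
  assumes K: "left_module R K" and F: "projective R F"
    and \<epsilon>: "\<epsilon> \<in> mod_hom R F K" "\<epsilon> ` carrier F = carrier K"
    and K': "left_module R K'" "K' = F\<lparr>carrier := a_kernel F K \<epsilon>\<rparr>"
  obtains \<phi> \<psi> h where
    "\<And>i. \<phi> i \<in> mod_hom R (free_res R K (Suc i)) (free_res R K' i)"
    "\<And>i. \<psi> i \<in> mod_hom R (free_res R K' i) (free_res R K (Suc i))"
    "\<And>i. h i \<in> mod_hom R (free_res R K i) (free_res R K (Suc i))"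
    "\<And>i x. x \<in> carrier (free_res R K (Suc (Suc i))) \<Longrightarrow>
      res_diff R K' i (\<phi> (Suc i) x) = \<phi> i (res_diff R K (Suc i) x)"
    "\<And>i x. x \<in> carrier (free_res R K' (Suc i)) \<Longrightarrow>
      res_diff R K (Suc i) (\<psi> (Suc i) x) = \<psi> i (res_diff R K' i x)"
    "\<And>i x. x \<in> carrier (free_res R K (Suc i)) \<Longrightarrow>
      x = \<psi> i (\<phi> i x) \<oplus>\<^bsub>free_res R K (Suc i)\<^esub>
        (res_diff R K (Suc i) (h (Suc i) x) \<oplus>\<^bsub>free_res R K (Suc i)\<^esub> h i (res_diff R K i x))"
proof -
  let ?Q = "free_res R K" and ?b = "res_diff R K" and ?P = "free_res R K'" and ?d = "res_diff R K'"
  let ?\<alpha> = "res_aug R K" and ?\<alpha>' = "res_aug R K'"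
  note resQ = free_res_exact[OF K] and resP = free_res_exact[OF K'(1)]
  note Q = exact_resolutionD[OF resQ] and P = exact_resolutionD[OF resP]
  note bb = exact_resolution_dd[OF resQ] and dd = exact_resolution_dd[OF resP]
  note pQ = free_res_maps(2)[OF K] and pP = free_res_maps(2)[OF K'(1)]
  have mF: "left_module R F" using F by (simp add: projective_def)
  interpret K: left_module R K by fact
  have K'_carrier: "y \<in> carrier K' \<longleftrightarrow> y \<in> carrier F \<and> \<epsilon> y = \<zero>\<^bsub>K\<^esub>" for y
    by (simp add: K'(2) a_kernel_def')
  have K'_zero: "\<zero>\<^bsub>K'\<^esub> = \<zero>\<^bsub>F\<^esub>" by (simp add: K'(2))
  have \<alpha>'F: "?\<alpha>' \<in> mod_hom R (?P 0) F"
    using P(3) by (auto simp: mod_hom_def K'(2) a_kernel_def')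
  obtain s where s: "s \<in> mod_hom R (?Q 0) F" "\<And>x. x \<in> carrier (?Q 0) \<Longrightarrow> \<epsilon> (s x) = ?\<alpha> x"
    using projective_lift[OF pQ mF K \<epsilon> Q(3)] by blast
  obtain t where t: "t \<in> mod_hom R F (?Q 0)" "\<And>x. x \<in> carrier F \<Longrightarrow> ?\<alpha> (t x) = \<epsilon> x"
    using projective_lift[OF F Q(2) K Q(3,5) \<epsilon>(1)] by blast
  have sb: "(\<lambda>x. s (?b 0 x)) \<in> mod_hom R (?Q (Suc 0)) F"
    by (rule mod_hom_compose[OF Q(4) s(1)])
  obtain \<phi>0 where \<phi>0: "\<phi>0 \<in> mod_hom R (?Q (Suc 0)) (?P 0)"
    "\<And>x. x \<in> carrier (?Q (Suc 0)) \<Longrightarrow> ?\<alpha>' (\<phi>0 x) = s (?b 0 x)"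
  proof (rule projective_lift_image[OF pQ P(2) mF \<alpha>'F sb])
    show "(\<lambda>x. s (?b 0 x)) ` carrier (?Q (Suc 0)) \<subseteq> ?\<alpha>' ` carrier (?P 0)"
      unfolding P(5) using bb(1) s(2) mod_homD(1)[OF sb] mod_homD(1)[OF Q(4)]
      by (auto simp: K'_carrier)
  qed (rule that)
  obtain \<phi> where \<phi>: "\<phi> 0 = \<phi>0" "\<And>i. \<phi> i \<in> mod_hom R (?Q (Suc i)) (?P i)"
    "\<And>i x. x \<in> carrier (?Q (Suc (Suc i))) \<Longrightarrow> ?d i (\<phi> (Suc i) x) = \<phi> i (?b (Suc i) x)"
  proof (rule chain_map_lift[of R "\<lambda>i. ?Q (Suc i)" "\<lambda>i. ?b (Suc i)", OF pQ Q(4) bb(2) resP \<phi>0(1)])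
    fix x assume x: "x \<in> carrier (?Q (Suc (Suc 0)))"
    show "?\<alpha>' (\<phi>0 (?b (Suc 0) x)) = \<zero>\<^bsub>K'\<^esub>"
      using \<phi>0(2)[OF mod_homD(1)[OF Q(4) x]] bb(2)[OF x] mod_hom_zero[OF Q(2) mF s(1)]
      by (simp add: K'_zero)
  qed (assumption | rule that)+
  have t\<alpha>: "(\<lambda>x. t (?\<alpha>' x)) \<in> mod_hom R (?P 0) (?Q 0)"
    by (rule mod_hom_compose[OF \<alpha>'F t(1)])
  obtain \<psi>0 where \<psi>0: "\<psi>0 \<in> mod_hom R (?P 0) (?Q (Suc 0))"
    "\<And>x. x \<in> carrier (?P 0) \<Longrightarrow> ?b 0 (\<psi>0 x) = t (?\<alpha>' x)"
  proof (rule projective_lift_image[OF pP Q(2) Q(2) Q(4) t\<alpha>])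
    show "(\<lambda>x. t (?\<alpha>' x)) ` carrier (?P 0) \<subseteq> ?b 0 ` carrier (?Q (Suc 0))"
      unfolding Q(6) using t(2) mod_homD(1)[OF t\<alpha>] mod_homD(1)[OF P(3)]
      by (auto simp: K'_carrier)
  qed (rule that)
  obtain \<psi> where \<psi>: "\<psi> 0 = \<psi>0" "\<And>i. \<psi> i \<in> mod_hom R (?P i) (?Q (Suc i))"
    "\<And>i x. x \<in> carrier (?P (Suc i)) \<Longrightarrow> ?b (Suc i) (\<psi> (Suc i) x) = \<psi> i (?d i x)"
  proof (rule chain_map_lift[OF pP P(4) dd(2) exact_resolution_shift[OF resQ] \<psi>0(1)])
    fix x assume x: "x \<in> carrier (?P (Suc 0))"
    show "?b 0 (\<psi>0 (?d 0 x)) = \<zero>\<^bsub>(?Q 0)\<lparr>carrier := ?b 0 ` carrier (?Q (Suc 0))\<rparr>\<^esub>"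
      using \<psi>0(2)[OF mod_homD(1)[OF P(4) x]] dd(1)[OF x] mod_hom_zero[OF mF Q(2) t(1)]
      by (simp add: K'_zero)
  qed (assumption | rule that)+
  \<comment> \<open>The endomorphism of \<open>Q\<close> obtained by going to the spliced resolution and back.\<close>
  define \<tau> where "\<tau> i = (case i of 0 \<Rightarrow> (\<lambda>x. t (s x)) | Suc j \<Rightarrow> (\<lambda>x. \<psi> j (\<phi> j x)))" for i
  have \<tau>: "\<tau> i \<in> mod_hom R (?Q i) (?Q i)" for i
    using mod_hom_compose[OF s(1) t(1)] mod_hom_compose[OF \<phi>(2) \<psi>(2)]
    by (cases i) (auto simp: \<tau>_def)
  have \<tau>_chain: "?b i (\<tau> (Suc i) x) = \<tau> i (?b i x)" if x: "x \<in> carrier (?Q (Suc i))" for i x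
  proof (cases i)
    case 0
    have "?b 0 (\<psi>0 (\<phi>0 x)) = t (s (?b 0 x))"
      using x \<psi>0(2)[OF mod_homD(1)[OF \<phi>0(1)]] \<phi>0(2) 0 by simp
    then show ?thesis by (simp add: \<tau>_def 0 \<phi>(1) \<psi>(1))
  next
    case (Suc j)
    then show ?thesis using x \<psi>(3)[OF mod_homD(1)[OF \<phi>(2)]] \<phi>(3) by (simp add: \<tau>_def)
  qed
  let ?\<theta> = "\<lambda>i x. x \<ominus>\<^bsub>?Q i\<^esub> \<tau> i x"
  have \<theta>: "?\<theta> i \<in> mod_hom R (?Q i) (?Q i)" for i
    by (rule mod_hom_diff[OF Q(2) mod_hom_id \<tau>])
  obtain h where h: "\<And>i. h i \<in> mod_hom R (?Q i) (?Q (Suc i))"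
    "\<And>i x. x \<in> carrier (?Q (Suc i)) \<Longrightarrow>
       ?b (Suc i) (h (Suc i) x) \<oplus>\<^bsub>?Q (Suc i)\<^esub> h i (?b i x) = ?\<theta> (Suc i) x"
  proof (rule null_homotopy[OF pQ Q(4) bb(2) resQ \<theta>])
    fix i x assume x: "x \<in> carrier (?Q (Suc i))"
    show "?b i (?\<theta> (Suc i) x) = ?\<theta> i (?b i x)"
      using mod_hom_minus[OF Q(2) Q(2) Q(4) x mod_homD(1)[OF \<tau> x]] \<tau>_chain[OF x] by simp
  next
    fix x assume x: "x \<in> carrier (?Q 0)"
    have "?\<alpha> (?\<theta> 0 x) = ?\<alpha> x \<ominus>\<^bsub>K\<^esub> ?\<alpha> (\<tau> 0 x)"
      by (rule mod_hom_minus[OF Q(2) K Q(3) x mod_homD(1)[OF \<tau> x]])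
    also have "\<dots> = \<zero>\<^bsub>K\<^esub>"
      using t(2)[OF mod_homD(1)[OF s(1) x]] s(2)[OF x] mod_homD(1)[OF Q(3) x]
      by (simp add: \<tau>_def K.M.minus_eq K.M.r_neg)
    finally show "?\<alpha> (?\<theta> 0 x) = \<zero>\<^bsub>K\<^esub>" .
  qed (assumption | rule that)+
  have "x = \<psi> i (\<phi> i x) \<oplus>\<^bsub>?Q (Suc i)\<^esub>
      (?b (Suc i) (h (Suc i) x) \<oplus>\<^bsub>?Q (Suc i)\<^esub> h i (?b i x))"
    if x: "x \<in> carrier (?Q (Suc i))" for i x
  proof -
    interpret Qs: left_module R "?Q (Suc i)" by (rule Q(2))
    have y: "\<psi> i (\<phi> i x) \<in> carrier (?Q (Suc i))" using mod_homD(1)[OF \<tau> x] by (simp add: \<tau>_def)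
    have "\<psi> i (\<phi> i x) \<oplus>\<^bsub>?Q (Suc i)\<^esub> (x \<ominus>\<^bsub>?Q (Suc i)\<^esub> \<psi> i (\<phi> i x)) = x"
      unfolding Qs.M.minus_eq Qs.M.a_comm[OF x Qs.M.a_inv_closed[OF y]]
      by (rule Qs.M.r_neg2[OF y x])
    then show ?thesis using h(2)[OF x] by (simp add: \<tau>_def)
  qed
  then show ?thesis using that[OF \<phi>(2) \<psi>(2) h(1) \<phi>(3) \<psi>(3)] by blast
qed

section \<open>Special modules are closed under syzygies\<close>

text \<open>
  In the defining sequence, \<open>F\<^sub>n\<close> maps onto \<open>K\<^sub>n\<^sub>-\<^sub>1\<close> with kernel \<open>K\<^sub>n\<close>. The shifted sequence, which
  resolves \<open>K\<^sub>0\<close>, still has finitely generated terms from degree \<open>n\<close> on, and its \<open>(n-1)\<close>st syzygy is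
  \<open>K\<^sub>n\<close>; so the kernel is special again.
\<close>

lemma special_super_fp_cover:
  fixes K :: "('r, 'u) module"
  assumes "special_super_fp R n K"
  obtains F K' :: "('r, 'u) module" and \<epsilon> where "left_module R K" "projective R F"
    "\<epsilon> \<in> mod_hom R F K" "\<epsilon> ` carrier F = carrier K"
    "left_module R K'" "K' = F\<lparr>carrier := a_kernel F K \<epsilon>\<rparr>" "special_super_fp R n K'"
proof -
  obtain U F e d where seq: "super_fp_seq R n U F e d" and K: "K = syzygy U F d n"
    using assms by (auto simp: special_super_fp_def)
  have res: "exact_resolution R U F e d" using seq by (simp add: super_fp_seq_def)
  note F = exact_resolutionD[OF res]
  let ?U' = "(F 0)\<lparr>carrier := d 0 ` carrier (F (Suc 0))\<rparr>"
  have seq': "super_fp_seq R n ?U' (\<lambda>i. F (Suc i)) (d 0) (\<lambda>i. d (Suc i))"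
    using seq exact_resolution_shift[OF res] by (simp add: super_fp_seq_def)
  let ?K' = "syzygy U F d (Suc n)"
  have "?K' = syzygy ?U' (\<lambda>i. F (Suc i)) (\<lambda>i. d (Suc i)) n"
    by (simp add: syzygy_def split: nat.split)
  with seq' have spec: "special_super_fp R n ?K'"
    unfolding special_super_fp_def by blast
  have mK': "left_module R ?K'"
    unfolding syzygy_def using left_module_image[OF F(2) F(2) F(4)] by simp
  have P: "projective R (F n)" using seq by (simp add: super_fp_seq_def)
  show ?thesis
  proof (cases n)
    case 0
    show ?thesis
    proof (rule that[of "F n" e "?K'"])
      show "projective R (F n)" "left_module R ?K'" "special_super_fp R n ?K'" by fact+
    qed (use F 0 K in \<open>simp_all add: syzygy_def a_kernel_def'\<close>)
  next
    case (Suc m)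
    show ?thesis
    proof (rule that[of "F n" "d m" "?K'"])
      show "projective R (F n)" "left_module R ?K'" "special_super_fp R n ?K'" by fact+
      show "left_module R K" using K Suc left_module_image[OF F(2) F(2) F(4)] by (simp add: syzygy_def)
      show "d m \<in> mod_hom R (F n) K"
        using K Suc mod_hom_restrict_codomain[OF F(4)] by (simp add: syzygy_def)
    qed (use F K Suc in \<open>simp_all add: syzygy_def a_kernel_def'\<close>)
  qed
qed

section \<open>Ext: vanishing, dimension shift and the long exact sequence\<close>

lemma (in comm_group) trivial_subquotient_iff:
  assumes Z: "subgroup Z G" and B: "subgroup B G" and BZ: "B \<subseteq> Z"
  shows "trivial_group (subquotient G Z B) \<longleftrightarrow> Z \<subseteq> B"
proof -
  let ?H = "G\<lparr>carrier := Z\<rparr>"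
  interpret H: group ?H using subgroup.subgroup_is_group[OF Z group_axioms] .
  interpret H: comm_group ?H
    by (rule H.group_comm_groupI) (use subgroup.subset[OF Z] in \<open>auto simp: m_comm subset_iff\<close>)
  have sB: "subgroup B ?H" using subgroup_incl[OF B Z BZ] .
  interpret N: normal B ?H using H.subgroup_imp_normal[OF sB] .
  have grp: "group (?H Mod B)" by (rule N.factorgroup_is_group)
  have "Z \<subseteq> B" if "(\<lambda>x. B #>\<^bsub>?H\<^esub> x) ` Z = {B}"
  proof
    fix x assume x: "x \<in> Z"
    then have "B #>\<^bsub>?H\<^esub> x = B" using that by blast
    moreover have "x \<in> B #>\<^bsub>?H\<^esub> x" using x H.rcos_self[OF _ sB, of x] by simp
    ultimately show "x \<in> B" by simp
  qed
  moreover have "(\<lambda>x. B #>\<^bsub>?H\<^esub> x) ` Z = {B}" if "Z \<subseteq> B"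
    using that BZ N.rcos_const H.coset_join2[OF _ sB] H.one_closed by auto
  ultimately show ?thesis
    using grp by (auto simp: trivial_group_def subquotient_def carrier_FactGroup)
qed

lemma mod_hom_restrict:
  assumes "left_module R M" "f \<in> mod_hom R M N"
  shows "restrict f (carrier M) \<in> mod_hom R M N"
proof -
  interpret M: left_module R M by fact
  show ?thesis using assms(2) by (auto simp: mod_hom_def)
qed

lemma comm_group_Hom_group:
  assumes "left_module R M" "left_module R N"
  shows "comm_group (Hom_group R M N)"
proof -
  interpret M: left_module R M by fact
  interpret N: left_module R N by fact
  note mh = mod_hom_restrict[OF assms(1)]
  have zero: "(\<lambda>x. \<zero>\<^bsub>N\<^esub>) \<in> mod_hom R M N" by (auto simp: mod_hom_def)
  have cl: "f x \<in> carrier N" if "f \<in> mod_hom R M N" "x \<in> carrier M" for f x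
    using mod_homD(1) that .
  show ?thesis
  proof (rule comm_groupI)
    fix f assume f: "f \<in> carrier (Hom_group R M N)"
    let ?g = "\<lambda>x\<in>carrier M. \<ominus>\<^bsub>N\<^esub> f x"
    have "?g \<in> carrier (Hom_group R M N)"
      using f mh[OF mod_hom_neg[OF assms(2)]] by (simp add: Hom_group_def)
    moreover have "?g \<otimes>\<^bsub>Hom_group R M N\<^esub> f = \<one>\<^bsub>Hom_group R M N\<^esub>"
      using f by (auto simp: Hom_group_def cl N.M.l_neg intro!: restrict_ext)
    ultimately show "\<exists>g\<in>carrier (Hom_group R M N). g \<otimes>\<^bsub>Hom_group R M N\<^esub> f = \<one>\<^bsub>Hom_group R M N\<^esub>"
      by blast
  next
    fix f assume "f \<in> carrier (Hom_group R M N)"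
    then show "\<one>\<^bsub>Hom_group R M N\<^esub> \<otimes>\<^bsub>Hom_group R M N\<^esub> f = f"
      by (intro extensionalityI[of _ "carrier M"]) (auto simp: Hom_group_def cl)
  qed (use mh[OF mod_hom_add[OF assms(2)]] mh[OF zero]
      in \<open>auto simp: Hom_group_def cl N.M.a_ac intro!: restrict_ext\<close>)
qed

lemma Hom_group_precompose:
  assumes "left_module R M" "left_module R M'" "d \<in> mod_hom R M' M"
  shows "(\<lambda>f. \<lambda>x\<in>carrier M'. f (d x)) \<in> hom (Hom_group R M N) (Hom_group R M' N)"
  using mod_homD(1)[OF assms(3)] mod_hom_restrict[OF assms(2) mod_hom_compose[OF assms(3)]]
  by (intro homI) (auto simp: Hom_group_def intro!: restrict_ext)

text \<open>
  The exactness of the Hom complex in a positive degree, freed from cosets and from the convention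
  that elements of \<open>Hom_group\<close> are undefined outside the carrier.
\<close>

lemma Ext_trivial_iff:
  assumes K: "left_module R K" and M: "left_module R M"
  shows "trivial_group (Ext R (Suc m) K M) \<longleftrightarrow>
    (\<forall>f\<in>mod_hom R (free_res R K (Suc m)) M.
      (\<forall>x\<in>carrier (free_res R K (Suc (Suc m))). f (res_diff R K (Suc m) x) = \<zero>\<^bsub>M\<^esub>) \<longrightarrow>
      (\<exists>g\<in>mod_hom R (free_res R K m) M.
        \<forall>x\<in>carrier (free_res R K (Suc m)). f x = g (res_diff R K m x)))"
    (is "_ \<longleftrightarrow> ?vanish")
proof -
  let ?Q = "free_res R K" and ?b = "res_diff R K"
  let ?C = "\<lambda>i. Hom_group R (?Q i) M"
  let ?\<delta> = "\<lambda>i f. \<lambda>x\<in>carrier (?Q (Suc i)). f (?b i x)"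
  let ?Z = "kernel (?C (Suc m)) (?C (Suc (Suc m))) (?\<delta> (Suc m))"
  let ?B = "?\<delta> m ` carrier (?C m)"
  note Q = free_res_maps[OF K] and bb = exact_resolution_dd(2)[OF free_res_exact[OF K]]
  have C: "comm_group (?C i)" for i by (rule comm_group_Hom_group[OF Q(1) M])
  interpret G: comm_group "?C (Suc m)" by (rule C)
  have \<delta>: "group_hom (?C i) (?C (Suc i)) (?\<delta> i)" for i
    using C Hom_group_precompose[OF Q(1) Q(1) Q(3)]
    by (intro group_hom.intro group_hom_axioms.intro) (auto simp: comm_group_def)
  have Z: "subgroup ?Z (?C (Suc m))" by (rule group_hom.subgroup_kernel[OF \<delta>])
  have B: "subgroup ?B (?C (Suc m))" by (rule group_hom.img_is_subgroup[OF \<delta>])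
  have Z_iff: "f \<in> ?Z \<longleftrightarrow> f \<in> mod_hom R (?Q (Suc m)) M \<and> f \<in> extensional (carrier (?Q (Suc m))) \<and>
      (\<forall>x\<in>carrier (?Q (Suc (Suc m))). f (?b (Suc m) x) = \<zero>\<^bsub>M\<^esub>)" for f
    by (auto simp: kernel_def Hom_group_def fun_eq_iff restrict_def)
  have BZ: "?B \<subseteq> ?Z"
  proof
    fix f assume f: "f \<in> ?B"
    then obtain g where g: "g \<in> mod_hom R (?Q m) M" and fg: "f = ?\<delta> m g"
      by (auto simp: Hom_group_def)
    have "f (?b (Suc m) x) = \<zero>\<^bsub>M\<^esub>" if x: "x \<in> carrier (?Q (Suc (Suc m)))" for x
      using bb[OF x] mod_homD(1)[OF Q(3) x] mod_hom_zero[OF Q(1) M g] by (simp add: fg)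
    moreover have "f \<in> carrier (?C (Suc m))" using subgroup.subset[OF B] f by blast
    ultimately show "f \<in> ?Z" unfolding Z_iff by (simp add: Hom_group_def)
  qed
  have "trivial_group (Ext R (Suc m) K M) \<longleftrightarrow> ?Z \<subseteq> ?B"
    using G.trivial_subquotient_iff[OF Z B BZ] by (simp add: Ext_def Let_def)
  also have "\<dots> \<longleftrightarrow> ?vanish"
  proof
    assume ZB: "?Z \<subseteq> ?B"
    show ?vanish
    proof (intro ballI impI)
      fix f assume f: "f \<in> mod_hom R (?Q (Suc m)) M"
        "\<forall>x\<in>carrier (?Q (Suc (Suc m))). f (?b (Suc m) x) = \<zero>\<^bsub>M\<^esub>"
      let ?f = "restrict f (carrier (?Q (Suc m)))"
      have "?f \<in> ?Z"
        unfolding Z_iff using mod_hom_restrict[OF Q(1) f(1)] f(2) mod_homD(1)[OF Q(3)] by simp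
      then obtain g where g: "g \<in> mod_hom R (?Q m) M" "?f = ?\<delta> m g"
        using ZB by (auto simp: Hom_group_def)
      have "f x = g (?b m x)" if "x \<in> carrier (?Q (Suc m))" for x
        using fun_cong[OF g(2), of x] that by simp
      then show "\<exists>g\<in>mod_hom R (?Q m) M. \<forall>x\<in>carrier (?Q (Suc m)). f x = g (?b m x)"
        using g(1) by blast
    qed
  next
    assume van: ?vanish
    show "?Z \<subseteq> ?B"
    proof
      fix f assume "f \<in> ?Z"
      note f = this[unfolded Z_iff]
      then obtain g where g: "g \<in> mod_hom R (?Q m) M"
        "\<And>x. x \<in> carrier (?Q (Suc m)) \<Longrightarrow> f x = g (?b m x)"
        using van by blast
      let ?g = "restrict g (carrier (?Q m))"
      have "f = ?\<delta> m ?g"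
        by (rule extensionalityI[of _ "carrier (?Q (Suc m))"])
           (use f g mod_homD(1)[OF Q(3)] in auto)
      moreover have "?g \<in> carrier (?C m)"
        using mod_hom_restrict[OF Q(1) g(1)] by (simp add: Hom_group_def)
      ultimately show "f \<in> ?B" by blast
    qed
  qed
  finally show ?thesis .
qed

lemma Ext_trivialD:
  assumes "trivial_group (Ext R (Suc m) K M)" "left_module R K" "left_module R M"
    and "f \<in> mod_hom R (free_res R K (Suc m)) M"
    and "\<And>x. x \<in> carrier (free_res R K (Suc (Suc m))) \<Longrightarrow> f (res_diff R K (Suc m) x) = \<zero>\<^bsub>M\<^esub>"
  obtains g where "g \<in> mod_hom R (free_res R K m) M"
    "\<And>x. x \<in> carrier (free_res R K (Suc m)) \<Longrightarrow> f x = g (res_diff R K m x)"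
  using assms(1)[unfolded Ext_trivial_iff[OF assms(2,3)], rule_format, OF assms(4,5)] by blast

text \<open>
  One direction of the isomorphism between \<open>Ext\<^sup>m\<^sup>+\<^sup>2(K, M)\<close> and \<open>Ext\<^sup>m\<^sup>+\<^sup>1(K', M)\<close>. For a cocycle
  \<open>f\<close> on the resolution of \<open>K\<close>, the cocycle \<open>f \<psi>\<close> on that of \<open>K'\<close> is a coboundary \<open>g d\<close>; composing
  with \<open>\<phi>\<close> and correcting by the homotopy makes \<open>f\<close> a coboundary, namely that of
  \<open>g \<phi> + f h\<close>.
\<close>

lemma Ext_shift:
  fixes K F :: "('r, 'u) module"
  assumes K: "left_module R K" and F: "projective R F"
    and \<epsilon>: "\<epsilon> \<in> mod_hom R F K" "\<epsilon> ` carrier F = carrier K"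
    and K': "left_module R K'" "K' = F\<lparr>carrier := a_kernel F K \<epsilon>\<rparr>"
    and M: "left_module R M" and van: "trivial_group (Ext R (Suc m) K' M)"
  shows "trivial_group (Ext R (Suc (Suc m)) K M)"
  unfolding Ext_trivial_iff[OF K M]
proof (intro ballI impI)
  let ?Q = "free_res R K" and ?b = "res_diff R K" and ?P = "free_res R K'" and ?d = "res_diff R K'"
  note Q = free_res_maps[OF K] and P = free_res_maps[OF K'(1)]
  interpret M: left_module R M by fact
  obtain \<phi> \<psi> h where \<phi>: "\<And>i. \<phi> i \<in> mod_hom R (?Q (Suc i)) (?P i)"
    and \<psi>: "\<And>i. \<psi> i \<in> mod_hom R (?P i) (?Q (Suc i))"
    and h: "\<And>i. h i \<in> mod_hom R (?Q i) (?Q (Suc i))"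
    and d\<phi>: "\<And>i x. x \<in> carrier (?Q (Suc (Suc i))) \<Longrightarrow> ?d i (\<phi> (Suc i) x) = \<phi> i (?b (Suc i) x)"
    and b\<psi>: "\<And>i x. x \<in> carrier (?P (Suc i)) \<Longrightarrow> ?b (Suc i) (\<psi> (Suc i) x) = \<psi> i (?d i x)"
    and htpy: "\<And>i x. x \<in> carrier (?Q (Suc i)) \<Longrightarrow> x = \<psi> i (\<phi> i x) \<oplus>\<^bsub>?Q (Suc i)\<^esub>
        (?b (Suc i) (h (Suc i) x) \<oplus>\<^bsub>?Q (Suc i)\<^esub> h i (?b i x))"
    using syzygy_comparison[OF K F \<epsilon> K'] by metis
  fix f assume f: "f \<in> mod_hom R (?Q (Suc (Suc m))) M"
    and cocycle: "\<forall>x\<in>carrier (?Q (Suc (Suc (Suc m)))). f (?b (Suc (Suc m)) x) = \<zero>\<^bsub>M\<^esub>"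
  have f\<psi>: "(\<lambda>x. f (\<psi> (Suc m) x)) \<in> mod_hom R (?P (Suc m)) M"
    by (rule mod_hom_compose[OF \<psi> f])
  have f\<psi>d: "f (\<psi> (Suc m) (?d (Suc m) x)) = \<zero>\<^bsub>M\<^esub>" if "x \<in> carrier (?P (Suc (Suc m)))" for x
    using cocycle mod_homD(1)[OF \<psi>] that by (simp flip: b\<psi>)
  obtain g where g: "g \<in> mod_hom R (?P m) M"
    "\<And>x. x \<in> carrier (?P (Suc m)) \<Longrightarrow> f (\<psi> (Suc m) x) = g (?d m x)"
    using Ext_trivialD[OF van K'(1) M f\<psi> f\<psi>d] by blast
  let ?g = "\<lambda>y. g (\<phi> m y) \<oplus>\<^bsub>M\<^esub> f (h (Suc m) y)"
  have "?g \<in> mod_hom R (?Q (Suc m)) M"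
    by (rule mod_hom_add[OF M mod_hom_compose[OF \<phi> g(1)] mod_hom_compose[OF h f]])
  moreover have "f x = ?g (?b (Suc m) x)" if x: "x \<in> carrier (?Q (Suc (Suc m)))" for x
  proof -
    note cl = mod_homD(1)
    have bx: "?b (Suc m) x \<in> carrier (?Q (Suc m))" by (rule cl[OF Q(3) x])
    have hx: "h (Suc (Suc m)) x \<in> carrier (?Q (Suc (Suc (Suc m))))" by (rule cl[OF h x])
    have c1: "\<psi> (Suc m) (\<phi> (Suc m) x) \<in> carrier (?Q (Suc (Suc m)))" by (rule cl[OF \<psi> cl[OF \<phi> x]])
    have c2: "?b (Suc (Suc m)) (h (Suc (Suc m)) x) \<in> carrier (?Q (Suc (Suc m)))" by (rule cl[OF Q(3) hx])
    have c3: "h (Suc m) (?b (Suc m) x) \<in> carrier (?Q (Suc (Suc m)))" by (rule cl[OF h bx])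
    interpret Qs: left_module R "?Q (Suc (Suc m))" by (rule Q(1))
    have "f x = f (\<psi> (Suc m) (\<phi> (Suc m) x) \<oplus>\<^bsub>?Q (Suc (Suc m))\<^esub>
        (?b (Suc (Suc m)) (h (Suc (Suc m)) x) \<oplus>\<^bsub>?Q (Suc (Suc m))\<^esub> h (Suc m) (?b (Suc m) x)))"
      by (rule arg_cong[OF htpy[OF x]])
    also have "\<dots> = f (\<psi> (Suc m) (\<phi> (Suc m) x)) \<oplus>\<^bsub>M\<^esub>
        (f (?b (Suc (Suc m)) (h (Suc (Suc m)) x)) \<oplus>\<^bsub>M\<^esub> f (h (Suc m) (?b (Suc m) x)))"
      using mod_homD(2)[OF f c1 Qs.M.a_closed[OF c2 c3]] mod_homD(2)[OF f c2 c3] by simp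
    also have "f (?b (Suc (Suc m)) (h (Suc (Suc m)) x)) = \<zero>\<^bsub>M\<^esub>" using cocycle hx by blast
    also have "f (\<psi> (Suc m) (\<phi> (Suc m) x)) = g (\<phi> m (?b (Suc m) x))"
      by (simp only: g(2)[OF cl[OF \<phi> x]] d\<phi>[OF x])
    also have "\<zero>\<^bsub>M\<^esub> \<oplus>\<^bsub>M\<^esub> f (h (Suc m) (?b (Suc m) x)) = f (h (Suc m) (?b (Suc m) x))"
      by (rule M.M.l_zero[OF cl[OF f c3]])
    finally show ?thesis .
  qed
  ultimately show "\<exists>g\<in>mod_hom R (?Q (Suc m)) M. \<forall>x\<in>carrier (?Q (Suc (Suc m))). f x = g (?b (Suc m) x)"
    by (intro bexI[of _ ?g] ballI)
qed

lemma short_exactD: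
  assumes "short_exact R A B C f g"
  shows "left_module R A" "left_module R B" "left_module R C"
    "f \<in> mod_hom R A B" "g \<in> mod_hom R B C" "inj_on f (carrier A)" "g ` carrier B = carrier C"
    "f ` carrier A = {x \<in> carrier B. g x = \<zero>\<^bsub>C\<^esub>}"
  using assms by (auto simp: short_exact_def a_kernel_def')

text \<open>
  The part \<open>Ext\<^sup>m\<^sup>+\<^sup>1(K, B) \<rightarrow> Ext\<^sup>m\<^sup>+\<^sup>1(K, C) \<rightarrow> Ext\<^sup>m\<^sup>+\<^sup>2(K, A)\<close> of the long exact sequence, by the
  diagram chase behind it: a cocycle with values in \<open>C\<close> lifts to a cochain \<open>f'\<close> with values in
  \<open>B\<close> because the resolution is projective, the coboundary of \<open>f'\<close> comes from a cocycle with values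
  in \<open>A\<close>, and subtracting a cochain that bounds the latter turns \<open>f'\<close> into a cocycle.
\<close>

lemma Ext_middle_exact:
  assumes K: "left_module R K" and ses: "short_exact R A B C i p"
    and A: "trivial_group (Ext R (Suc (Suc m)) K A)"
    and B: "trivial_group (Ext R (Suc m) K B)"
  shows "trivial_group (Ext R (Suc m) K C)"
proof -
  let ?Q = "free_res R K" and ?b = "res_diff R K"
  note S = short_exactD[OF ses] and Q = free_res_maps[OF K]
  note bb = exact_resolution_dd(2)[OF free_res_exact[OF K]] and cl = mod_homD(1)
  interpret A: left_module R A by (rule S(1))
  interpret B: left_module R B by (rule S(2))
  interpret C: left_module R C by (rule S(3))
  show ?thesis
    unfolding Ext_trivial_iff[OF K S(3)]
  proof (intro ballI impI)
    fix f assume f: "f \<in> mod_hom R (?Q (Suc m)) C"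
      and cocycle: "\<forall>x\<in>carrier (?Q (Suc (Suc m))). f (?b (Suc m) x) = \<zero>\<^bsub>C\<^esub>"
    obtain f' where f': "f' \<in> mod_hom R (?Q (Suc m)) B"
      "\<And>x. x \<in> carrier (?Q (Suc m)) \<Longrightarrow> p (f' x) = f x"
      using projective_lift[OF Q(2) S(2,3,5,7) f] by blast
    have f'b: "(\<lambda>x. f' (?b (Suc m) x)) \<in> mod_hom R (?Q (Suc (Suc m))) B"
      by (rule mod_hom_compose[OF Q(3) f'(1)])
    have "(\<lambda>x. f' (?b (Suc m) x)) ` carrier (?Q (Suc (Suc m))) \<subseteq> i ` carrier A"
      unfolding S(8) using cocycle f'(2)[OF cl[OF Q(3)]] cl[OF f'b] by auto
    then obtain a where a: "a \<in> mod_hom R (?Q (Suc (Suc m))) A"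
      "\<And>x. x \<in> carrier (?Q (Suc (Suc m))) \<Longrightarrow> i (a x) = f' (?b (Suc m) x)"
      using projective_lift_image[OF Q(2) S(1,2,4) f'b] by blast
    have ab: "a (?b (Suc (Suc m)) x) = \<zero>\<^bsub>A\<^esub>" if x: "x \<in> carrier (?Q (Suc (Suc (Suc m))))" for x
    proof (rule inj_onD[OF S(6)])
      have bx: "?b (Suc (Suc m)) x \<in> carrier (?Q (Suc (Suc m)))" by (rule cl[OF Q(3) x])
      show "i (a (?b (Suc (Suc m)) x)) = i \<zero>\<^bsub>A\<^esub>"
        using a(2)[OF bx] bb[OF x] mod_hom_zero[OF Q(1) S(2) f'(1)] mod_hom_zero[OF S(1,2,4)]
        by simp
      show "a (?b (Suc (Suc m)) x) \<in> carrier A" by (rule cl[OF a(1) bx])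
    qed simp
    obtain a' where a': "a' \<in> mod_hom R (?Q (Suc m)) A"
      "\<And>x. x \<in> carrier (?Q (Suc (Suc m))) \<Longrightarrow> a x = a' (?b (Suc m) x)"
      using Ext_trivialD[OF A K S(1) a(1) ab] by blast
    let ?f = "\<lambda>x. f' x \<ominus>\<^bsub>B\<^esub> i (a' x)"
    have ia': "(\<lambda>x. i (a' x)) \<in> mod_hom R (?Q (Suc m)) B" by (rule mod_hom_compose[OF a'(1) S(4)])
    have g: "?f \<in> mod_hom R (?Q (Suc m)) B" by (rule mod_hom_diff[OF S(2) f'(1) ia'])
    have gb: "?f (?b (Suc m) x) = \<zero>\<^bsub>B\<^esub>" if x: "x \<in> carrier (?Q (Suc (Suc m)))" for x
    proof -
      have "i (a' (?b (Suc m) x)) = f' (?b (Suc m) x)" using a(2)[OF x] a'(2)[OF x] by simp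
      then show ?thesis
        using cl[OF f'b x] by (simp add: B.M.minus_eq B.M.r_neg)
    qed
    obtain u where u: "u \<in> mod_hom R (?Q m) B"
      "\<And>x. x \<in> carrier (?Q (Suc m)) \<Longrightarrow> ?f x = u (?b m x)"
      using Ext_trivialD[OF B K S(2) g gb] by blast
    have "f x = p (u (?b m x))" if x: "x \<in> carrier (?Q (Suc m))" for x
    proof -
      have "p (?f x) = p (f' x) \<ominus>\<^bsub>C\<^esub> p (i (a' x))"
        by (rule mod_hom_minus[OF S(2,3,5) cl[OF f'(1) x] cl[OF ia' x]])
      moreover have "i (a' x) \<in> i ` carrier A" using cl[OF a'(1) x] by simp
      then have "p (i (a' x)) = \<zero>\<^bsub>C\<^esub>" unfolding S(8) by simp
      ultimately show ?thesis using f'(2)[OF x] cl[OF f x] u(2)[OF x] by (simp add: C.M.minus_eq)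
    qed
    then show "\<exists>g\<in>mod_hom R (?Q m) C. \<forall>x\<in>carrier (?Q (Suc m)). f x = g (?b m x)"
      by (intro bexI[OF _ mod_hom_compose[OF u(1) S(5)]] ballI)
  qed
qed

section \<open>Tensor products through representatives in the free abelian group\<close>

lemma opposite_ring_simps [simp]:
  "carrier (opposite_ring R) = carrier R" "\<zero>\<^bsub>opposite_ring R\<^esub> = \<zero>\<^bsub>R\<^esub>" "\<one>\<^bsub>opposite_ring R\<^esub> = \<one>\<^bsub>R\<^esub>"
  "a \<otimes>\<^bsub>opposite_ring R\<^esub> b = b \<otimes>\<^bsub>R\<^esub> a" "a \<oplus>\<^bsub>opposite_ring R\<^esub> b = a \<oplus>\<^bsub>R\<^esub> b"
  by (simp_all add: opposite_ring_def)

lemma mod_hom_opposite_ring [simp]: "mod_hom (opposite_ring R) = mod_hom R"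
  by (simp add: mod_hom_def fun_eq_iff)

text \<open>
  The map induced by \<open>f\<close> and \<open>g\<close> between the free abelian groups of which tensor products are
  quotients. Elements of a tensor product are handled below through representatives: equality is
  the statement that a difference lies in \<open>tensor_rels\<close>, and functoriality is literal
  (\<open>frag_map2_compose\<close>).
\<close>

definition frag_map2 :: "('a \<Rightarrow> 'c) \<Rightarrow> ('b \<Rightarrow> 'd) \<Rightarrow> (('a \<times> 'b) \<Rightarrow>\<^sub>0 int) \<Rightarrow> (('c \<times> 'd) \<Rightarrow>\<^sub>0 int)" where
  "frag_map2 f g = frag_extend (\<lambda>(x, p). frag_of (f x, g p))"

lemma frag_map2_simps [simp]:
  "frag_map2 f g 0 = 0"
  "frag_map2 f g (frag_of (x, p)) = frag_of (f x, g p)"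
  "frag_map2 f g (a + b) = frag_map2 f g a + frag_map2 f g b"
  "frag_map2 f g (a - b) = frag_map2 f g a - frag_map2 f g b"
  by (simp_all add: frag_map2_def frag_extend_add frag_extend_diff)

lemma frag_map2_sum: "frag_map2 f g (\<Sum>s\<in>T. c s) = (\<Sum>s\<in>T. frag_map2 f g (c s))"
  by (induction T rule: infinite_finite_induct) auto

lemma frag_map2_compose:
  "frag_map2 f g (frag_map2 f' g' c) = frag_map2 (\<lambda>x. f (f' x)) (\<lambda>p. g (g' p)) c"
  using subset_UNIV[of "Poly_Mapping.keys c"] by (induction c rule: frag_induction) auto

lemma frag_map2_id: "frag_map2 (\<lambda>x. x) (\<lambda>p. p) c = c"
  using subset_UNIV[of "Poly_Mapping.keys c"] by (induction c rule: frag_induction) auto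

lemma frag_map2_keys:
  assumes "Poly_Mapping.keys c \<subseteq> A \<times> B"
    and "\<And>x. x \<in> A \<Longrightarrow> f x \<in> A'" "\<And>p. p \<in> B \<Longrightarrow> g p \<in> B'"
  shows "Poly_Mapping.keys (frag_map2 f g c) \<subseteq> A' \<times> B'"
  unfolding frag_map2_def
proof (rule order_trans[OF keys_frag_extend], rule UN_least)
  fix y assume "y \<in> Poly_Mapping.keys c"
  then have "y \<in> A \<times> B" using assms(1) by blast
  then show "Poly_Mapping.keys (case y of (x, p) \<Rightarrow> frag_of (f x, g p)) \<subseteq> A' \<times> B'"
    using assms(2,3) by auto
qed

lemma frag_map2_cong:
  assumes "Poly_Mapping.keys c \<subseteq> A \<times> B"
    and "\<And>x. x \<in> A \<Longrightarrow> f x = f' x" "\<And>p. p \<in> B \<Longrightarrow> g p = g' p"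
  shows "frag_map2 f g c = frag_map2 f' g' c"
  unfolding frag_map2_def by (rule frag_extend_eq) (use assms in auto)

lemma keys_diff_subset:
  "Poly_Mapping.keys a \<subseteq> S \<Longrightarrow> Poly_Mapping.keys b \<subseteq> S \<Longrightarrow> Poly_Mapping.keys (a - b :: 'a \<Rightarrow>\<^sub>0 int) \<subseteq> S"
  using keys_diff[of a b] by blast

lemma keys_add_subset:
  "Poly_Mapping.keys a \<subseteq> S \<Longrightarrow> Poly_Mapping.keys b \<subseteq> S \<Longrightarrow> Poly_Mapping.keys (a + b :: 'a \<Rightarrow>\<^sub>0 int) \<subseteq> S"
  using Poly_Mapping.keys_add[of a b] by blast

locale tensor_pair = N: left_module "opposite_ring R" N + P: left_module R P
  for R :: "('r, 'x) ring_scheme" and N :: "('r, 'n) module" and P :: "('r, 'p) module"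
begin

abbreviation "rels \<equiv> tensor_rels R N P"
abbreviation "pairs \<equiv> carrier N \<times> carrier P"

lemma subgroup_rels: "subgroup rels (free_Abelian_group pairs)"
  unfolding tensor_rels_def
proof (rule group.generate_is_subgroup[OF group_free_Abelian_group], rule subsetI)
  have smult: "a \<odot>\<^bsub>N\<^esub> x \<in> carrier N" if "a \<in> carrier R" "x \<in> carrier N" for a x
    using N.smult_closed that by simp
  fix c assume "c \<in> {frag_of (x \<oplus>\<^bsub>N\<^esub> y, p) - frag_of (x, p) - frag_of (y, p) | x y p.
         x \<in> carrier N \<and> y \<in> carrier N \<and> p \<in> carrier P} \<union>
      {frag_of (x, p \<oplus>\<^bsub>P\<^esub> q) - frag_of (x, p) - frag_of (x, q) | x p q.
         x \<in> carrier N \<and> p \<in> carrier P \<and> q \<in> carrier P} \<union>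
      {frag_of (a \<odot>\<^bsub>N\<^esub> x, p) - frag_of (x, a \<odot>\<^bsub>P\<^esub> p) | a x p.
         a \<in> carrier R \<and> x \<in> carrier N \<and> p \<in> carrier P}"
  then show "c \<in> carrier (free_Abelian_group pairs)"
    unfolding carrier_free_Abelian_group_iff
    by (elim UnE CollectE exE conjE; hypsubst; intro keys_diff_subset) (simp_all add: smult)
qed

lemma rels_keys: "c \<in> rels \<Longrightarrow> Poly_Mapping.keys c \<subseteq> pairs"
  using subgroup.mem_carrier[OF subgroup_rels] by simp

lemma rels_zero [simp]: "0 \<in> rels"
  using subgroup.one_closed[OF subgroup_rels] by simp

lemma rels_add: "a \<in> rels \<Longrightarrow> b \<in> rels \<Longrightarrow> a + b \<in> rels"
  using subgroup.m_closed[OF subgroup_rels] by simp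

lemma rels_minus: "a \<in> rels \<Longrightarrow> - a \<in> rels"
  using subgroup.m_inv_closed[OF subgroup_rels, of a] rels_keys[of a] by simp

lemma rels_diff: "a \<in> rels \<Longrightarrow> b \<in> rels \<Longrightarrow> a - b \<in> rels"
  using rels_add[OF _ rels_minus, of a b] by simp

lemma rels_sum: "(\<And>s. s \<in> T \<Longrightarrow> c s \<in> rels) \<Longrightarrow> (\<Sum>s\<in>T. c s) \<in> rels"
  by (induction T rule: infinite_finite_induct) (auto intro: rels_add)

lemma rels_gens:
  "x \<in> carrier N \<Longrightarrow> y \<in> carrier N \<Longrightarrow> p \<in> carrier P \<Longrightarrow>
    frag_of (x \<oplus>\<^bsub>N\<^esub> y, p) - frag_of (x, p) - frag_of (y, p) \<in> rels"
  "x \<in> carrier N \<Longrightarrow> p \<in> carrier P \<Longrightarrow> q \<in> carrier P \<Longrightarrow>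
    frag_of (x, p \<oplus>\<^bsub>P\<^esub> q) - frag_of (x, p) - frag_of (x, q) \<in> rels"
  "a \<in> carrier R \<Longrightarrow> x \<in> carrier N \<Longrightarrow> p \<in> carrier P \<Longrightarrow>
    frag_of (a \<odot>\<^bsub>N\<^esub> x, p) - frag_of (x, a \<odot>\<^bsub>P\<^esub> p) \<in> rels"
  unfolding tensor_rels_def by (rule generate.incl, blast)+

lemma rels_frag_zero:
  shows "x \<in> carrier N \<Longrightarrow> frag_of (x, \<zero>\<^bsub>P\<^esub>) \<in> rels" "p \<in> carrier P \<Longrightarrow> frag_of (\<zero>\<^bsub>N\<^esub>, p) \<in> rels"
  using rels_minus[OF rels_gens(2)[of x "\<zero>\<^bsub>P\<^esub>" "\<zero>\<^bsub>P\<^esub>"]]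
    rels_minus[OF rels_gens(1)[of "\<zero>\<^bsub>N\<^esub>" "\<zero>\<^bsub>N\<^esub>" p]] by simp_all

lemma rels_frag_diff:
  assumes "x \<in> carrier N" "y \<in> carrier N" "p \<in> carrier P"
  shows "frag_of (x \<ominus>\<^bsub>N\<^esub> y, p) - (frag_of (x, p) - frag_of (y, p)) \<in> rels"
proof -
  have "x \<ominus>\<^bsub>N\<^esub> y \<oplus>\<^bsub>N\<^esub> y = x"
    using assms by (simp add: N.M.minus_eq N.M.a_assoc N.M.l_neg)
  then have r: "frag_of (x, p) - frag_of (x \<ominus>\<^bsub>N\<^esub> y, p) - frag_of (y, p) \<in> rels"
    using rels_gens(1)[OF N.M.minus_closed[OF assms(1,2)] assms(2,3)] by simp
  have "frag_of (x \<ominus>\<^bsub>N\<^esub> y, p) - (frag_of (x, p) - frag_of (y, p)) =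
      - (frag_of (x, p) - frag_of (x \<ominus>\<^bsub>N\<^esub> y, p) - frag_of (y, p))"
    by (simp add: algebra_simps)
  then show ?thesis using rels_minus[OF r] by (simp only:)
qed

text \<open>
  The universal property of the tensor product, for homomorphisms that are only required to send
  the generating relations into a given subgroup.
\<close>

lemma rels_hom_image:
  assumes H: "group H" "subgroup W H" and h: "h \<in> hom (free_Abelian_group pairs) H"
    and gens: "\<And>x y p. x \<in> carrier N \<Longrightarrow> y \<in> carrier N \<Longrightarrow> p \<in> carrier P \<Longrightarrow>
        h (frag_of (x \<oplus>\<^bsub>N\<^esub> y, p) - frag_of (x, p) - frag_of (y, p)) \<in> W"
      "\<And>x p q. x \<in> carrier N \<Longrightarrow> p \<in> carrier P \<Longrightarrow> q \<in> carrier P \<Longrightarrow>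
        h (frag_of (x, p \<oplus>\<^bsub>P\<^esub> q) - frag_of (x, p) - frag_of (x, q)) \<in> W"
      "\<And>a x p. a \<in> carrier R \<Longrightarrow> x \<in> carrier N \<Longrightarrow> p \<in> carrier P \<Longrightarrow>
        h (frag_of (a \<odot>\<^bsub>N\<^esub> x, p) - frag_of (x, a \<odot>\<^bsub>P\<^esub> p)) \<in> W"
    and c: "c \<in> rels"
  shows "h c \<in> W"
proof -
  interpret h: group_hom "free_Abelian_group pairs" H h
    using H(1) h by (simp add: group_hom_def group_hom_axioms_def)
  from c show ?thesis
    unfolding tensor_rels_def
  proof (induction c rule: generate.induct)
    case one
    then show ?case using h.hom_one subgroup.one_closed[OF H(2)] by simp
  next
    case (incl c)
    then show ?case by (elim UnE CollectE exE conjE) (simp_all only: gens)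
  next
    case (inv c)
    then have "c \<in> rels" unfolding tensor_rels_def by (rule generate.incl)
    moreover have "h c \<in> W" using inv by (elim UnE CollectE exE conjE) (simp_all only: gens)
    ultimately show ?case
      using h.hom_inv[of c] rels_keys[of c] subgroup.m_inv_closed[OF H(2)] by simp
  next
    case (eng a b)
    then have "a \<in> rels" "b \<in> rels" unfolding tensor_rels_def by blast+
    then show ?case
      using h.hom_mult[of a b] rels_keys eng subgroup.m_closed[OF H(2)] by simp
  qed
qed

end

lemma frag_map2_rels:
  assumes "tensor_pair R N P" "tensor_pair R N' P'"
    and f: "f \<in> mod_hom R N N'" and g: "g \<in> mod_hom R P P'" and c: "c \<in> tensor_rels R N P"
  shows "frag_map2 f g c \<in> tensor_rels R N' P'"
proof -
  interpret D: tensor_pair R N P by fact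
  interpret E: tensor_pair R N' P' by fact
  note f = mod_homD[OF f] and g = mod_homD[OF g]
  have h: "frag_map2 f g \<in> hom (free_Abelian_group D.pairs) (free_Abelian_group E.pairs)"
    using frag_map2_keys[of _ "carrier N" "carrier P" f "carrier N'" g "carrier P'"] f(1) g(1)
    by (intro homI) (simp_all only: carrier_free_Abelian_group_iff mult_free_Abelian_group frag_map2_simps)
  show ?thesis
    by (rule D.rels_hom_image[OF group_free_Abelian_group E.subgroup_rels h _ _ _ c])
       (simp_all only: frag_map2_simps f g E.rels_gens)
qed

context tensor_pair
begin

text \<open>
  Additivity of \<open>N \<otimes> _\<close> on maps; in contrast to compatibility with composition it holds only
  up to relations.
\<close>

lemma frag_map2_add_rels:
  assumes "left_module R P'" and g: "g \<in> mod_hom R P' P" and h: "h \<in> mod_hom R P' P"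
    and c: "Poly_Mapping.keys c \<subseteq> carrier N \<times> carrier P'"
  shows "frag_map2 (\<lambda>x. x) (\<lambda>p. g p \<oplus>\<^bsub>P\<^esub> h p) c
    - (frag_map2 (\<lambda>x. x) g c + frag_map2 (\<lambda>x. x) h c) \<in> rels"
  using c
proof (induction c rule: frag_induction)
  case (diff a b)
  from rels_diff[OF diff] show ?case by (simp add: algebra_simps)
next
  case (one a)
  then show ?case
    using rels_gens(2) mod_homD(1)[OF g] mod_homD(1)[OF h] by (cases a) (simp add: diff_diff_eq)
qed simp

lemma frag_map2_zero_rels:
  assumes c: "Poly_Mapping.keys c \<subseteq> A \<times> B"
  shows "(\<And>x. x \<in> A \<Longrightarrow> f x \<in> carrier N) \<Longrightarrow> frag_map2 f (\<lambda>_. \<zero>\<^bsub>P\<^esub>) c \<in> rels"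
    and "(\<And>p. p \<in> B \<Longrightarrow> g p \<in> carrier P) \<Longrightarrow> frag_map2 (\<lambda>_. \<zero>\<^bsub>N\<^esub>) g c \<in> rels"
proof -
  assume f: "\<And>x. x \<in> A \<Longrightarrow> f x \<in> carrier N"
  show "frag_map2 f (\<lambda>_. \<zero>\<^bsub>P\<^esub>) c \<in> rels"
    using c
  proof (induction c rule: frag_induction)
    case (one a)
    then show ?case using f rels_frag_zero(1) by (cases a) simp
  qed (simp_all add: rels_diff)
next
  assume g: "\<And>p. p \<in> B \<Longrightarrow> g p \<in> carrier P"
  show "frag_map2 (\<lambda>_. \<zero>\<^bsub>N\<^esub>) g c \<in> rels"
    using c
  proof (induction c rule: frag_induction)
    case (one a)
    then show ?case using g rels_frag_zero(2) by (cases a) simp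
  qed (simp_all add: rels_diff)
qed

end

section \<open>Tor: vanishing in terms of representatives\<close>

context tensor_pair
begin

lemma comm_group_tensor: "comm_group (tensor R N P)"
  unfolding tensor_def
  by (rule comm_group.abelian_FactGroup[OF abelian_free_Abelian_group subgroup_rels])

abbreviation coset :: "(('n \<times> 'p) \<Rightarrow>\<^sub>0 int) \<Rightarrow> (('n \<times> 'p) \<Rightarrow>\<^sub>0 int) set" where
  "coset c \<equiv> rels #>\<^bsub>free_Abelian_group pairs\<^esub> c"

lemma carrier_tensor: "carrier (tensor R N P) = coset ` {c. Poly_Mapping.keys c \<subseteq> pairs}"
  by (simp add: tensor_def carrier_FactGroup free_Abelian_group_def)

lemma one_tensor: "\<one>\<^bsub>tensor R N P\<^esub> = rels"
  by (simp add: tensor_def)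

lemma mult_tensor:
  assumes "Poly_Mapping.keys a \<subseteq> pairs" "Poly_Mapping.keys b \<subseteq> pairs"
  shows "coset a \<otimes>\<^bsub>tensor R N P\<^esub> coset b = coset (a + b)"
proof -
  interpret F: comm_group "free_Abelian_group pairs" by (rule abelian_free_Abelian_group)
  interpret W: normal rels "free_Abelian_group pairs"
    by (rule F.subgroup_imp_normal[OF subgroup_rels])
  show ?thesis using W.rcos_sum[of a b] assms by (simp add: tensor_def)
qed

lemma coset_eq: "coset c = {r + c | r. r \<in> rels}"
  by (auto simp: r_coset_def)

lemma coset_eq_iff:
  "coset a = coset b \<longleftrightarrow> a - b \<in> rels"
proof
  assume "coset a = coset b"
  moreover have "a \<in> coset a" unfolding coset_eq using rels_zero by force
  ultimately show "a - b \<in> rels" by (auto simp: coset_eq)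
next
  assume ab: "a - b \<in> rels"
  have "r + a \<in> coset b" if "r \<in> rels" for r
    unfolding coset_eq using rels_add[OF that ab] by (auto simp: algebra_simps intro!: exI[of _ "r + (a - b)"])
  moreover have "r + b \<in> coset a" if "r \<in> rels" for r
    unfolding coset_eq using rels_diff[OF that ab] by (auto simp: algebra_simps intro!: exI[of _ "r - (a - b)"])
  ultimately show "coset a = coset b" unfolding coset_eq[of a] coset_eq[of b] by blast
qed

lemma coset_eq_rels: "coset c = rels \<longleftrightarrow> c \<in> rels"
  using coset_eq_iff[of c 0] by (simp add: coset_eq)

end

lemma tensor_map_coset:
  assumes "tensor_pair R N P" "tensor_pair R N Q" "d \<in> mod_hom R P Q"
  shows "tensor_map R N Q d (tensor_pair.coset R N P c) = tensor_pair.coset R N Q (frag_map2 (\<lambda>x. x) d c)"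
proof -
  interpret P: tensor_pair R N P by fact
  interpret Q: tensor_pair R N Q by fact
  have W: "frag_map2 (\<lambda>x. x) d r \<in> Q.rels" if "r \<in> P.rels" for r
    by (rule frag_map2_rels[OF assms(1,2) mod_hom_id assms(3) that])
  have "tensor_map R N Q d (P.coset c) =
      {s + (frag_map2 (\<lambda>x. x) d r + frag_map2 (\<lambda>x. x) d c) | r s. r \<in> P.rels \<and> s \<in> Q.rels}"
    unfolding tensor_map_def set_mult_def P.coset_eq frag_map2_def[symmetric] mult_free_Abelian_group
      frag_map2_simps(3)[symmetric]
    by blast
  also have "\<dots> = Q.coset (frag_map2 (\<lambda>x. x) d c)"
    unfolding Q.coset_eq
  proof (intro equalityI subsetI)
    fix y assume "y \<in> {s + (frag_map2 (\<lambda>x. x) d r + frag_map2 (\<lambda>x. x) d c) | r s. r \<in> P.rels \<and> s \<in> Q.rels}"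
    then obtain r s where "r \<in> P.rels" "s \<in> Q.rels"
      and y: "y = (s + frag_map2 (\<lambda>x. x) d r) + frag_map2 (\<lambda>x. x) d c"
      by (auto simp: add.assoc)
    then have "s + frag_map2 (\<lambda>x. x) d r \<in> Q.rels" using W Q.rels_add by blast
    then show "y \<in> {r + frag_map2 (\<lambda>x. x) d c | r. r \<in> Q.rels}" using y by blast
  next
    fix y assume "y \<in> {r + frag_map2 (\<lambda>x. x) d c | r. r \<in> Q.rels}"
    then obtain s where "s \<in> Q.rels"
      "y = s + (frag_map2 (\<lambda>x. x) d 0 + frag_map2 (\<lambda>x. x) d c)" by auto
    then show "y \<in> {s + (frag_map2 (\<lambda>x. x) d r + frag_map2 (\<lambda>x. x) d c) | r s. r \<in> P.rels \<and> s \<in> Q.rels}"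
      using P.rels_zero by blast
  qed
  finally show ?thesis .
qed

lemma tensor_map_group_hom:
  assumes "tensor_pair R N P" "tensor_pair R N Q" "d \<in> mod_hom R P Q"
  shows "group_hom (tensor R N P) (tensor R N Q) (tensor_map R N Q d)"
proof -
  interpret P: tensor_pair R N P by fact
  interpret Q: tensor_pair R N Q by fact
  have keys: "Poly_Mapping.keys (frag_map2 (\<lambda>x. x) d c) \<subseteq> Q.pairs" if "Poly_Mapping.keys c \<subseteq> P.pairs" for c
    by (rule frag_map2_keys[OF that]) (use mod_homD(1)[OF assms(3)] in auto)
  have "tensor_map R N Q d \<in> hom (tensor R N P) (tensor R N Q)"
  proof (rule homI)
    fix X assume "X \<in> carrier (tensor R N P)"
    then obtain a where "X = P.coset a" "Poly_Mapping.keys a \<subseteq> P.pairs"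
      unfolding P.carrier_tensor by blast
    then show "tensor_map R N Q d X \<in> carrier (tensor R N Q)"
      unfolding Q.carrier_tensor using keys tensor_map_coset[OF assms] by auto
  next
    fix X Y assume "X \<in> carrier (tensor R N P)" "Y \<in> carrier (tensor R N P)"
    then obtain a b where X: "X = P.coset a" "Poly_Mapping.keys a \<subseteq> P.pairs"
      and Y: "Y = P.coset b" "Poly_Mapping.keys b \<subseteq> P.pairs"
      unfolding P.carrier_tensor by blast
    show "tensor_map R N Q d (X \<otimes>\<^bsub>tensor R N P\<^esub> Y) =
        tensor_map R N Q d X \<otimes>\<^bsub>tensor R N Q\<^esub> tensor_map R N Q d Y"
      unfolding X(1) Y(1) P.mult_tensor[OF X(2) Y(2)] tensor_map_coset[OF assms]
        Q.mult_tensor[OF keys[OF X(2)] keys[OF Y(2)]] by simp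
  qed
  then show ?thesis
    using P.comm_group_tensor Q.comm_group_tensor
    by (simp add: group_hom_def group_hom_axioms_def comm_group_def)
qed

lemma tensor_pairI: "right_module R N \<Longrightarrow> left_module R P \<Longrightarrow> tensor_pair R N P"
  by (simp add: tensor_pair_def)

text \<open>
  Tensoring the resolution with \<open>N\<close> gives a complex.
\<close>

lemma push_push_rels:
  assumes K: "left_module R K" and N: "right_module R N"
    and w: "Poly_Mapping.keys w \<subseteq> carrier N \<times> carrier (free_res R K (Suc (Suc m)))"
  shows "frag_map2 (\<lambda>x. x) (res_diff R K m) (frag_map2 (\<lambda>x. x) (res_diff R K (Suc m)) w)
    \<in> tensor_rels R N (free_res R K m)"
proof -
  interpret T: tensor_pair R N "free_res R K m" by (rule tensor_pairI[OF N free_res_maps(1)[OF K]])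
  have "frag_map2 (\<lambda>x. x) (\<lambda>p. res_diff R K m (res_diff R K (Suc m) p)) w =
      frag_map2 (\<lambda>x. x) (\<lambda>_. \<zero>\<^bsub>free_res R K m\<^esub>) w"
    by (rule frag_map2_cong[OF w]) (simp_all add: exact_resolution_dd(2)[OF free_res_exact[OF K]])
  also have "\<dots> \<in> T.rels" by (rule T.frag_map2_zero_rels(1)[OF w])
  finally show ?thesis by (simp only: frag_map2_compose)
qed

text \<open>
  Exactness of the tensored resolution in a positive degree, in terms of representatives: a chain
  that is a cycle modulo relations is a boundary modulo relations.
\<close>

lemma Tor_trivial_iff:
  assumes K: "left_module R K" and N: "right_module R N"
  shows "trivial_group (Tor R (Suc m) N K) \<longleftrightarrow>
    (\<forall>c. Poly_Mapping.keys c \<subseteq> carrier N \<times> carrier (free_res R K (Suc m)) \<longrightarrow>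
      frag_map2 (\<lambda>x. x) (res_diff R K m) c \<in> tensor_rels R N (free_res R K m) \<longrightarrow>
      (\<exists>w. Poly_Mapping.keys w \<subseteq> carrier N \<times> carrier (free_res R K (Suc (Suc m))) \<and>
        c - frag_map2 (\<lambda>x. x) (res_diff R K (Suc m)) w \<in> tensor_rels R N (free_res R K (Suc m))))"
    (is "_ \<longleftrightarrow> ?vanish")
proof -
  let ?Q = "free_res R K" and ?b = "res_diff R K"
  let ?T = "\<lambda>i. tensor R N (?Q i)" and ?D = "\<lambda>i. tensor_map R N (?Q i) (?b i)"
  let ?push = "\<lambda>i. frag_map2 (\<lambda>x. x) (?b i)"
  note Q = free_res_maps[OF K]
  have tp: "tensor_pair R N (?Q i)" for i by (rule tensor_pairI[OF N Q(1)])
  interpret T: tensor_pair R N "?Q i" for i by (rule tp)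
  interpret G: comm_group "?T (Suc m)" by (rule T.comm_group_tensor)
  note D = tensor_map_coset[OF tp tp Q(3)] and D_hom = tensor_map_group_hom[OF tp tp Q(3)]
  let ?Z = "kernel (?T (Suc m)) (?T m) (?D m)" and ?B = "?D (Suc m) ` carrier (?T (Suc (Suc m)))"
  have Z: "subgroup ?Z (?T (Suc m))" by (rule group_hom.subgroup_kernel[OF D_hom])
  have B: "subgroup ?B (?T (Suc m))" by (rule group_hom.img_is_subgroup[OF D_hom])
  have Z_eq: "?Z = T.coset (Suc m) ` {c. Poly_Mapping.keys c \<subseteq> carrier N \<times> carrier (?Q (Suc m)) \<and>
      ?push m c \<in> tensor_rels R N (?Q m)}"
    unfolding kernel_def T.carrier_tensor T.one_tensor
  proof (intro equalityI subsetI)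
    fix X assume "X \<in> T.coset (Suc m) ` {c. Poly_Mapping.keys c \<subseteq> carrier N \<times> carrier (?Q (Suc m)) \<and>
      ?push m c \<in> tensor_rels R N (?Q m)}"
    then obtain c where "X = T.coset (Suc m) c" "Poly_Mapping.keys c \<subseteq> carrier N \<times> carrier (?Q (Suc m))"
      and c: "?push m c \<in> tensor_rels R N (?Q m)" by blast
    moreover from c have "?D m (T.coset (Suc m) c) = tensor_rels R N (?Q m)"
      by (simp only: D T.coset_eq_rels)
    ultimately show "X \<in> {X \<in> T.coset (Suc m) ` {c. Poly_Mapping.keys c \<subseteq> carrier N \<times> carrier (?Q (Suc m))}.
        ?D m X = tensor_rels R N (?Q m)}" by blast
  qed (auto simp: D T.coset_eq_rels)
  have B_eq: "?B = (\<lambda>w. T.coset (Suc m) (?push (Suc m) w)) `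
      {w. Poly_Mapping.keys w \<subseteq> carrier N \<times> carrier (?Q (Suc (Suc m)))}"
    by (simp add: T.carrier_tensor D image_image)
  have push_keys: "Poly_Mapping.keys (?push i c) \<subseteq> carrier N \<times> carrier (?Q i)"
    if "Poly_Mapping.keys c \<subseteq> carrier N \<times> carrier (?Q (Suc i))" for i c
    by (rule frag_map2_keys[OF that]) (use mod_homD(1)[OF Q(3)] in auto)
  have push_push: "?push m (?push (Suc m) w) \<in> tensor_rels R N (?Q m)"
    if w: "Poly_Mapping.keys w \<subseteq> carrier N \<times> carrier (?Q (Suc (Suc m)))" for w
    by (rule push_push_rels[OF K N w])
  have BZ: "?B \<subseteq> ?Z"
    unfolding Z_eq B_eq using push_keys push_push by blast
  have "trivial_group (Tor R (Suc m) N K) \<longleftrightarrow> ?Z \<subseteq> ?B"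
    using G.trivial_subquotient_iff[OF Z B BZ] by (simp add: Tor_def Let_def)
  also have "\<dots> \<longleftrightarrow> ?vanish"
    unfolding Z_eq B_eq image_subset_iff by (auto simp: image_iff T.coset_eq_iff)
  finally show ?thesis .
qed

lemma Tor_trivialD:
  assumes "trivial_group (Tor R (Suc m) N K)" "left_module R K" "right_module R N"
    and "Poly_Mapping.keys c \<subseteq> carrier N \<times> carrier (free_res R K (Suc m))"
    and "frag_map2 (\<lambda>x. x) (res_diff R K m) c \<in> tensor_rels R N (free_res R K m)"
  obtains w where "Poly_Mapping.keys w \<subseteq> carrier N \<times> carrier (free_res R K (Suc (Suc m)))"
    "c - frag_map2 (\<lambda>x. x) (res_diff R K (Suc m)) w \<in> tensor_rels R N (free_res R K (Suc m))"
  using assms(1)[unfolded Tor_trivial_iff[OF assms(2,3)], rule_format, OF assms(4,5)] by blast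

section \<open>Flatness of free modules\<close>

text \<open>
  The coordinate at \<open>b\<close> of an element of \<open>N \<otimes> R\<^sup>(\<^sup>B\<^sup>)\<close>, under the identification of this group with the
  finitely supported functions from \<open>B\<close> to \<open>N\<close>. It sends \<open>x \<otimes> v\<close> to \<open>x v\<^sub>b\<close>, written
  \<open>v b \<odot>\<^bsub>N\<^esub> x\<close> for a right module, and exists since the free abelian group is free.
\<close>

definition tensor_coord ::
    "('r, 'x) ring_scheme \<Rightarrow> ('r, 'n) module \<Rightarrow> 'b set \<Rightarrow> 'b \<Rightarrow> (('n \<times> ('b \<Rightarrow> 'r)) \<Rightarrow>\<^sub>0 int) \<Rightarrow> 'n" where
  "tensor_coord R N B b = (SOME h.
     h \<in> hom (free_Abelian_group (carrier N \<times> carrier (free_module R B))) (add_monoid N) \<and>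
     (\<forall>x\<in>carrier N. \<forall>v\<in>carrier (free_module R B). h (frag_of (x, v)) = v b \<odot>\<^bsub>N\<^esub> x))"

lemma (in abelian_group) add_minus_minus:
  assumes "x \<in> carrier G" "y \<in> carrier G"
  shows "x \<oplus> y \<ominus> x \<ominus> y = \<zero>"
proof -
  have "x \<oplus> y \<ominus> x \<ominus> y = (x \<oplus> y) \<oplus> \<ominus> (x \<oplus> y)"
    using assms by (simp add: minus_eq minus_add a_assoc)
  then show ?thesis using assms by (simp add: r_neg)
qed

locale free_tensor_pair = tensor_pair R N "free_module R B"
  for R :: "('r, 'x) ring_scheme" and N :: "('r, 'n) module" and B :: "'b set"
begin

abbreviation "coord \<equiv> tensor_coord R N B"

lemma coord_hom: "coord b \<in> hom (free_Abelian_group pairs) (add_monoid N)"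
  and coord_frag_of: "x \<in> carrier N \<Longrightarrow> v \<in> carrier (free_module R B) \<Longrightarrow>
    coord b (frag_of (x, v)) = v b \<odot>\<^bsub>N\<^esub> x"
proof -
  have im: "(\<lambda>(x, v). v b \<odot>\<^bsub>N\<^esub> x) ` pairs \<subseteq> carrier (add_monoid N)"
    using N.smult_closed by (auto simp: free_module_carrier)
  obtain h where "h \<in> hom (free_Abelian_group pairs) (add_monoid N)"
    "\<And>y. y \<in> pairs \<Longrightarrow> h (frag_of y) = (\<lambda>(x, v). v b \<odot>\<^bsub>N\<^esub> x) y"
    by (rule comm_group.free_Abelian_group_universal[OF N.M.a_comm_group im]) (rule that)
  then have "\<exists>h. h \<in> hom (free_Abelian_group pairs) (add_monoid N) \<and>
     (\<forall>x\<in>carrier N. \<forall>v\<in>carrier (free_module R B). h (frag_of (x, v)) = v b \<odot>\<^bsub>N\<^esub> x)"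
    by (intro exI[of _ h]) auto
  from someI_ex[OF this]
  have *: "coord b \<in> hom (free_Abelian_group pairs) (add_monoid N) \<and>
     (\<forall>x\<in>carrier N. \<forall>v\<in>carrier (free_module R B). coord b (frag_of (x, v)) = v b \<odot>\<^bsub>N\<^esub> x)"
    unfolding tensor_coord_def .
  then show "coord b \<in> hom (free_Abelian_group pairs) (add_monoid N)" by blast
  from * show "x \<in> carrier N \<Longrightarrow> v \<in> carrier (free_module R B) \<Longrightarrow>
    coord b (frag_of (x, v)) = v b \<odot>\<^bsub>N\<^esub> x" by blast
qed

lemma coord_group_hom: "group_hom (free_Abelian_group pairs) (add_monoid N) (coord b)"
  using coord_hom N.M.a_comm_group by (simp add: group_hom_def group_hom_axioms_def comm_group_def)

lemma coord_closed: "Poly_Mapping.keys c \<subseteq> pairs \<Longrightarrow> coord b c \<in> carrier N"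
  using group_hom.hom_closed[OF coord_group_hom, of c] by simp

lemma coord_zero: "coord b 0 = \<zero>\<^bsub>N\<^esub>"
  using group_hom.hom_one[OF coord_group_hom] by simp

lemma coord_diff:
  assumes "Poly_Mapping.keys a \<subseteq> pairs" "Poly_Mapping.keys c \<subseteq> pairs"
  shows "coord b (a - c) = coord b a \<ominus>\<^bsub>N\<^esub> coord b c"
proof -
  have "coord b (- c) = \<ominus>\<^bsub>N\<^esub> coord b c"
    using group_hom.hom_inv[OF coord_group_hom, of c] assms(2) by (simp add: a_inv_def)
  then show ?thesis
    using group_hom.hom_mult[OF coord_group_hom, of a "- c"] assms by (simp add: N.M.minus_eq)
qed

lemma coord_rels:
  assumes "c \<in> rels"
  shows "coord b c = \<zero>\<^bsub>N\<^esub>"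
proof -
  have sm: "a \<in> carrier R \<Longrightarrow> x \<in> carrier N \<Longrightarrow> a \<odot>\<^bsub>N\<^esub> x \<in> carrier N" for a x
    using N.smult_closed by simp
  have v: "v \<in> carrier (free_module R B) \<Longrightarrow> v b \<in> carrier R" for v
    by (simp add: free_module_carrier)
  have "coord b c \<in> {\<zero>\<^bsub>N\<^esub>}"
  proof (rule rels_hom_image[OF N.M.a_group _ coord_hom _ _ _ assms])
    show "subgroup {\<zero>\<^bsub>N\<^esub>} (add_monoid N)" using group.triv_subgroup[OF N.M.a_group] by simp
  next
    fix x y p assume a: "x \<in> carrier N" "y \<in> carrier N" "p \<in> carrier (free_module R B)"
    then show "coord b (frag_of (x \<oplus>\<^bsub>N\<^esub> y, p) - frag_of (x, p) - frag_of (y, p)) \<in> {\<zero>\<^bsub>N\<^esub>}"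
      using sm[OF v] N.smult_r_distr[of "p b" x y] v
      by (simp add: coord_diff coord_frag_of keys_diff_subset N.M.add_minus_minus)
  next
    fix x p q assume a: "x \<in> carrier N" "p \<in> carrier (free_module R B)" "q \<in> carrier (free_module R B)"
    then show "coord b (frag_of (x, p \<oplus>\<^bsub>free_module R B\<^esub> q) - frag_of (x, p) - frag_of (x, q)) \<in> {\<zero>\<^bsub>N\<^esub>}"
      using sm[OF v] N.smult_l_distr[of "p b" "q b" x] v P.M.a_closed[of p q]
      by (simp add: coord_diff coord_frag_of keys_diff_subset N.M.add_minus_minus)
  next
    fix a x p assume a: "a \<in> carrier R" "x \<in> carrier N" "p \<in> carrier (free_module R B)"
    then show "coord b (frag_of (a \<odot>\<^bsub>N\<^esub> x, p) - frag_of (x, a \<odot>\<^bsub>free_module R B\<^esub> p)) \<in> {\<zero>\<^bsub>N\<^esub>}"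
      using sm v N.smult_assoc[of "p b" a x] P.smult_closed[of a p]
      by (simp add: coord_diff coord_frag_of N.M.minus_eq N.M.r_neg)
  qed
  then show ?thesis by simp
qed

text \<open>
  The sum of the \<open>x\<^sub>b \<otimes> e\<^sub>b\<close> over \<open>T\<close>, for the coordinates \<open>x\<^sub>b\<close> of \<open>c\<close>. Keeping the index set as a
  parameter makes sums for different \<open>c\<close> comparable term by term.
\<close>

definition "normal_form c T = (\<Sum>b\<in>T. frag_of (coord b c, basis_vec R b))"

text \<open>
  The identification with finitely supported functions is injective: \<open>c\<close> is recovered from its
  coordinates. Allowing every finite set above some \<open>S\<close>, rather than the exact support, makes the
  property visibly closed under differences, since two such sets can be enlarged to a common one.
\<close>

definition "expands c \<longleftrightarrow> Poly_Mapping.keys c \<subseteq> pairs \<and>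
  (\<exists>S. finite S \<and> S \<subseteq> B \<and> (\<forall>T. finite T \<longrightarrow> S \<subseteq> T \<longrightarrow> T \<subseteq> B \<longrightarrow> c - normal_form c T \<in> rels))"

lemma expands_rels:
  assumes c: "c \<in> rels"
  shows "expands c"
proof -
  have "normal_form c T \<in> rels" if "T \<subseteq> B" for T
    unfolding normal_form_def
  proof (rule rels_sum)
    fix b assume "b \<in> T"
    then show "frag_of (coord b c, basis_vec R b) \<in> rels"
      using that rels_frag_zero(2)[OF basis_vec_closed[OF P.ring_axioms, of b B]] coord_rels[OF c] by auto
  qed
  then have "c - normal_form c T \<in> rels" if "T \<subseteq> B" for T
    using rels_diff c that by blast
  then show ?thesis
    unfolding expands_def using rels_keys[OF c] by blast
qed

lemma expands_diff:
  assumes "expands a" "expands c"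
  shows "expands (a - c)"
proof -
  obtain S1 where a: "Poly_Mapping.keys a \<subseteq> pairs" and S1: "finite S1" "S1 \<subseteq> B"
    "\<And>T. finite T \<Longrightarrow> S1 \<subseteq> T \<Longrightarrow> T \<subseteq> B \<Longrightarrow> a - normal_form a T \<in> rels"
    using assms(1) unfolding expands_def by blast
  obtain S2 where c: "Poly_Mapping.keys c \<subseteq> pairs" and S2: "finite S2" "S2 \<subseteq> B"
    "\<And>T. finite T \<Longrightarrow> S2 \<subseteq> T \<Longrightarrow> T \<subseteq> B \<Longrightarrow> c - normal_form c T \<in> rels"
    using assms(2) unfolding expands_def by blast
  have "a - c - normal_form (a - c) T \<in> rels"
    if T: "finite T" "S1 \<union> S2 \<subseteq> T" "T \<subseteq> B" for T
  proof -
    have "normal_form (a - c) T - (normal_form a T - normal_form c T) =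
        (\<Sum>b\<in>T. frag_of (coord b a \<ominus>\<^bsub>N\<^esub> coord b c, basis_vec R b) -
          (frag_of (coord b a, basis_vec R b) - frag_of (coord b c, basis_vec R b)))"
      by (simp add: normal_form_def sum_subtractf coord_diff[OF a c])
    also have "\<dots> \<in> rels"
      by (intro rels_sum rels_frag_diff coord_closed a c basis_vec_closed P.ring_axioms) (use T in auto)
    finally have r: "normal_form (a - c) T - (normal_form a T - normal_form c T) \<in> rels" .
    have "a - normal_form a T \<in> rels" "c - normal_form c T \<in> rels"
      using S1(3)[of T] S2(3)[of T] T by auto
    from rels_diff[OF rels_diff[OF this] r] have "(a - normal_form a T) - (c - normal_form c T) -
        (normal_form (a - c) T - (normal_form a T - normal_form c T)) \<in> rels" .
    then show ?thesis by (simp add: algebra_simps)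
  qed
  then show ?thesis
    unfolding expands_def using keys_diff_subset[OF a c] S1(1,2) S2(1,2)
    by (intro conjI exI[of _ "S1 \<union> S2"]) auto
qed

lemma expands_add:
  assumes "expands a" "expands c"
  shows "expands (a + c)"
  using expands_diff[OF assms(1) expands_diff[OF expands_rels[OF rels_zero] assms(2)]] by simp

lemma expands_basis:
  assumes x: "x \<in> carrier N" and b: "b \<in> B"
  shows "expands (frag_of (x, basis_vec R b))"
proof -
  let ?c = "frag_of (x, basis_vec R b)"
  have e: "basis_vec R b' \<in> carrier (free_module R B)" if "b' \<in> B" for b'
    by (rule basis_vec_closed[OF P.ring_axioms that])
  have coord: "coord b' ?c = (if b' = b then x else \<zero>\<^bsub>N\<^esub>)" for b'
    using x N.smult_one[of x] N.smult_zeros(1)[of x]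
    unfolding coord_frag_of[OF x e[OF b]] by (simp add: basis_vec_def)
  have "?c - normal_form ?c T \<in> rels" if T: "finite T" "{b} \<subseteq> T" "T \<subseteq> B" for T
  proof -
    have "normal_form ?c T = ?c + (\<Sum>b'\<in>T - {b}. frag_of (\<zero>\<^bsub>N\<^esub>, basis_vec R b'))"
      unfolding normal_form_def coord using T by (subst sum.remove[of T b]) auto
    moreover have "(\<Sum>b'\<in>T - {b}. frag_of (\<zero>\<^bsub>N\<^esub>, basis_vec R b')) \<in> rels"
      by (intro rels_sum rels_frag_zero e) (use T in auto)
    ultimately show ?thesis using rels_minus by simp
  qed
  then show ?thesis
    unfolding expands_def using x e b by (intro conjI exI[of _ "{b}"]) auto
qed

text \<open>
  Writing \<open>v\<close> as a formal linear combination reduces the claim to \<open>x \<otimes> a e\<^sub>b = x a \<otimes> e\<^sub>b\<close>.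
\<close>

lemma expands_frag_of:
  assumes x: "x \<in> carrier N" and v: "v \<in> carrier (free_module R B)"
  shows "expands (frag_of (x, v))"
proof -
  obtain l where l: "set l \<subseteq> carrier R \<times> B" "lincomb R l = v"
    using lincomb_surj[OF P.ring_axioms v] .
  have "expands (frag_of (x, lincomb R l))" using l(1)
  proof (induction l)
    case Nil
    then show ?case using expands_rels rels_frag_zero(1)[OF x] by simp
  next
    case (Cons q l)
    obtain a b where q: "q = (a, b)" by fastforce
    have a: "a \<in> carrier R" "b \<in> B" "set l \<subseteq> carrier R \<times> B" using Cons.prems q by auto
    let ?e = "basis_vec R b" and ?w = "lincomb R l"
    have e: "?e \<in> carrier (free_module R B)" by (rule basis_vec_closed[OF P.ring_axioms a(2)])
    have w: "?w \<in> carrier (free_module R B)" by (rule lincomb_closed[OF P.ring_axioms a(3)])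
    have ax: "a \<odot>\<^bsub>N\<^esub> x \<in> carrier N" using N.smult_closed a(1) x by simp
    have ae: "a \<odot>\<^bsub>free_module R B\<^esub> ?e \<in> carrier (free_module R B)" by (rule P.smult_closed[OF a(1) e])
    have lin: "lincomb R (q # l) = (a \<odot>\<^bsub>free_module R B\<^esub> ?e) \<oplus>\<^bsub>free_module R B\<^esub> ?w"
      using a(1) by (auto simp: q basis_vec_def)
    have "frag_of (x, lincomb R (q # l)) =
        (frag_of (x, lincomb R (q # l)) - frag_of (x, a \<odot>\<^bsub>free_module R B\<^esub> ?e) - frag_of (x, ?w))
        - (frag_of (a \<odot>\<^bsub>N\<^esub> x, ?e) - frag_of (x, a \<odot>\<^bsub>free_module R B\<^esub> ?e))
        + (frag_of (a \<odot>\<^bsub>N\<^esub> x, ?e) + frag_of (x, ?w))"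
      by (simp add: algebra_simps)
    also have "expands \<dots>"
      unfolding lin
      by (intro expands_add expands_diff expands_rels rels_gens(2,3) expands_basis Cons.IH ax ae x w e a)
    finally show ?case .
  qed
  then show ?thesis by (simp add: l)
qed

lemma expands: "Poly_Mapping.keys c \<subseteq> pairs \<Longrightarrow> expands c"
  by (induction c rule: frag_induction)
    (auto intro: expands_diff expands_frag_of expands_rels)

lemma coord_normal_form:
  assumes "Poly_Mapping.keys c \<subseteq> pairs"
  obtains T where "finite T" "T \<subseteq> B" "c - normal_form c T \<in> rels"
  using expands[OF assms] unfolding expands_def by blast

end

text \<open>
  Coordinates commute with maps of the right module. Together with \<open>coord_normal_form\<close>
  this reduces exactness questions for \<open>_ \<otimes> R\<^sup>(\<^sup>B\<^sup>)\<close> to the individual coordinates.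
\<close>

lemma coord_natural:
  assumes "free_tensor_pair R N B" "free_tensor_pair R N' B" and f: "f \<in> mod_hom R N N'"
    and c: "Poly_Mapping.keys c \<subseteq> carrier N \<times> carrier (free_module R B)"
  shows "tensor_coord R N' B b (frag_map2 f (\<lambda>p. p) c) = f (tensor_coord R N B b c)"
proof -
  interpret N: free_tensor_pair R N B by fact
  interpret N': free_tensor_pair R N' B by fact
  have f': "f \<in> mod_hom (opposite_ring R) N N'" using f by simp
  have "Poly_Mapping.keys c \<subseteq> N.pairs \<and> N'.coord b (frag_map2 f (\<lambda>p. p) c) = f (N.coord b c)"
    using c
  proof (induction c rule: frag_induction)
    case zero
    then show ?case
      using mod_hom_zero[OF N.N.left_module_axioms N'.N.left_module_axioms f']
      by (simp add: N.coord_zero N'.coord_zero)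
  next
    case (one a)
    then obtain x v where a: "a = (x, v)" "x \<in> carrier N" "v \<in> carrier (free_module R B)" by blast
    have "v b \<in> carrier R" using a by (simp add: free_module_carrier)
    then show ?case
      using a mod_homD(1,3)[OF f] by (simp add: N.coord_frag_of N'.coord_frag_of)
  next
    case (diff a d)
    then have a: "Poly_Mapping.keys a \<subseteq> N.pairs" and d: "Poly_Mapping.keys d \<subseteq> N.pairs"
      and IH: "N'.coord b (frag_map2 f (\<lambda>p. p) a) = f (N.coord b a)"
        "N'.coord b (frag_map2 f (\<lambda>p. p) d) = f (N.coord b d)" by blast+
    have keys: "Poly_Mapping.keys (frag_map2 f (\<lambda>p. p) c) \<subseteq> N'.pairs"
      if "Poly_Mapping.keys c \<subseteq> N.pairs" for c
      by (rule frag_map2_keys[OF that]) (use mod_homD(1)[OF f] in auto)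
    have "f (N.coord b (a - d)) = f (N.coord b a) \<ominus>\<^bsub>N'\<^esub> f (N.coord b d)"
      unfolding N.coord_diff[OF a d]
      by (rule mod_hom_minus[OF N.N.left_module_axioms N'.N.left_module_axioms f'
            N.coord_closed[OF a] N.coord_closed[OF d]])
    then show ?case
      using keys_diff_subset[OF a d] by (simp only: frag_map2_simps N'.coord_diff[OF keys[OF a] keys[OF d]] IH)
  qed
  then show ?thesis by blast
qed

text \<open>
  Flatness of free modules: the coordinates of \<open>u\<close> vanish, because their images under the
  injective map \<open>i\<close> do, so that \<open>u\<close> agrees with a sum of symbols \<open>0 \<otimes> e\<^sub>b\<close>.
\<close>

lemma free_tensor_injective:
  assumes A: "free_tensor_pair R A B" and A': "free_tensor_pair R A' B"
    and i: "i \<in> mod_hom R A A'" "inj_on i (carrier A)"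
    and u: "Poly_Mapping.keys u \<subseteq> carrier A \<times> carrier (free_module R B)"
    and iu: "frag_map2 i (\<lambda>p. p) u \<in> tensor_rels R A' (free_module R B)"
  shows "u \<in> tensor_rels R A (free_module R B)"
proof -
  interpret A: free_tensor_pair R A B by fact
  interpret A': free_tensor_pair R A' B by fact
  have i': "i \<in> mod_hom (opposite_ring R) A A'" using i by simp
  have zero: "A.coord b u = \<zero>\<^bsub>A\<^esub>" for b
  proof (rule inj_onD[OF i(2)])
    show "i (A.coord b u) = i \<zero>\<^bsub>A\<^esub>"
      unfolding coord_natural[OF A A' i(1) u, symmetric] A'.coord_rels[OF iu]
        mod_hom_zero[OF A.N.left_module_axioms A'.N.left_module_axioms i'] ..
  qed (use A.coord_closed[OF u] in auto)
  obtain T where T: "finite T" "T \<subseteq> B" "u - A.normal_form u T \<in> A.rels"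
    by (rule A.coord_normal_form[OF u])
  have "A.normal_form u T \<in> A.rels"
    unfolding A.normal_form_def zero
    by (intro A.rels_sum A.rels_frag_zero basis_vec_closed A.P.ring_axioms) (use T in auto)
  from A.rels_add[OF T(3) this] show ?thesis by simp
qed

text \<open>
  A preimage of \<open>w\<close> is assembled from preimages of its coordinates.
\<close>

lemma free_tensor_exact:
  assumes A: "free_tensor_pair R A B" and M: "free_tensor_pair R M B" and C: "free_tensor_pair R C B"
    and i: "i \<in> mod_hom R A M" and p: "p \<in> mod_hom R M C"
    and exact: "{x \<in> carrier M. p x = \<zero>\<^bsub>C\<^esub>} \<subseteq> i ` carrier A"
    and w: "Poly_Mapping.keys w \<subseteq> carrier M \<times> carrier (free_module R B)"
    and pw: "frag_map2 p (\<lambda>q. q) w \<in> tensor_rels R C (free_module R B)"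
  obtains u where "Poly_Mapping.keys u \<subseteq> carrier A \<times> carrier (free_module R B)"
    "w - frag_map2 i (\<lambda>q. q) u \<in> tensor_rels R M (free_module R B)"
proof -
  interpret A: free_tensor_pair R A B by fact
  interpret M: free_tensor_pair R M B by fact
  interpret C: free_tensor_pair R C B by fact
  have "p (M.coord b w) = \<zero>\<^bsub>C\<^esub>" for b
    using coord_natural[OF M C p w, of b] C.coord_rels[OF pw, of b] by simp
  then have ex: "M.coord b w \<in> i ` carrier A" for b
    using M.coord_closed[OF w, of b] exact by blast
  define a where "a b = inv_into (carrier A) i (M.coord b w)" for b
  have a: "a b \<in> carrier A" "i (a b) = M.coord b w" for b
    unfolding a_def by (rule inv_into_into[OF ex], rule f_inv_into_f[OF ex])
  obtain T where T: "finite T" "T \<subseteq> B" "w - M.normal_form w T \<in> M.rels"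
    by (rule M.coord_normal_form[OF w])
  let ?u = "\<Sum>b\<in>T. frag_of (a b, basis_vec R b)"
  have "basis_vec R b \<in> carrier (free_module R B)" if "b \<in> T" for b
    by (rule basis_vec_closed[OF A.P.ring_axioms]) (use T(2) that in auto)
  then have "?u \<in> carrier (free_Abelian_group A.pairs)"
    using a(1) by (intro sum_closed_free_Abelian_group) simp
  moreover have "frag_map2 i (\<lambda>q. q) ?u = M.normal_form w T"
    by (simp add: frag_map2_sum M.normal_form_def a)
  ultimately show ?thesis using that[of ?u] T(3) by simp
qed

text \<open>
  A set-theoretic section of \<open>p\<close> suffices, as representatives map functorially along arbitrary
  functions.
\<close>

lemma tensor_surjective:
  assumes "p ` M = C" and v: "Poly_Mapping.keys v \<subseteq> C \<times> Q"
  obtains w where "Poly_Mapping.keys w \<subseteq> M \<times> Q" "frag_map2 p (\<lambda>q. q) w = v"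
proof -
  define \<sigma> where "\<sigma> = inv_into M p"
  have \<sigma>: "\<sigma> x \<in> M" "p (\<sigma> x) = x" if "x \<in> C" for x
    using that inv_into_into[of x p M] f_inv_into_f[of x p M] assms(1) by (simp_all add: \<sigma>_def)
  have "frag_map2 p (\<lambda>q. q) (frag_map2 \<sigma> (\<lambda>q. q) v) = v"
    unfolding frag_map2_compose using frag_map2_cong[OF v, of "\<lambda>x. p (\<sigma> x)" "\<lambda>x. x" "\<lambda>q. q" "\<lambda>q. q"] \<sigma>
    by (simp add: frag_map2_id)
  then show ?thesis
    by (rule that[rotated]) (rule frag_map2_keys[OF v], use \<sigma> in auto)
qed

section \<open>Tor: dimension shift and the long exact sequence\<close>

text \<open>
  The counterpart of \<open>Ext_shift\<close>. A cycle \<open>z\<close> over the resolution of \<open>K\<close> gives the cycle \<open>\<phi> z\<close> over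
  that of \<open>K'\<close>, which is a boundary \<open>d w\<close>; by the homotopy, \<open>z\<close> is then the boundary of
  \<open>\<psi> w + h z\<close>.
\<close>

lemma Tor_shift:
  fixes K F :: "('r, 'u) module"
  assumes K: "left_module R K" and F: "projective R F"
    and \<epsilon>: "\<epsilon> \<in> mod_hom R F K" "\<epsilon> ` carrier F = carrier K"
    and K': "left_module R K'" "K' = F\<lparr>carrier := a_kernel F K \<epsilon>\<rparr>"
    and N: "right_module R N" and van: "trivial_group (Tor R (Suc m) N K')"
  shows "trivial_group (Tor R (Suc (Suc m)) N K)"
  unfolding Tor_trivial_iff[OF K N]
proof (intro allI impI)
  let ?Q = "free_res R K" and ?b = "res_diff R K" and ?P = "free_res R K'" and ?d = "res_diff R K'"
  let ?push = "frag_map2 (\<lambda>x. x)"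
  note Q = free_res_maps[OF K] and P = free_res_maps[OF K'(1)]
  have tQ: "tensor_pair R N (?Q i)" and tP: "tensor_pair R N (?P i)" for i
    by (rule tensor_pairI[OF N Q(1)], rule tensor_pairI[OF N P(1)])
  interpret TQ: tensor_pair R N "?Q i" for i by (rule tQ)
  obtain \<phi> \<psi> h where \<phi>: "\<And>i. \<phi> i \<in> mod_hom R (?Q (Suc i)) (?P i)"
    and \<psi>: "\<And>i. \<psi> i \<in> mod_hom R (?P i) (?Q (Suc i))"
    and h: "\<And>i. h i \<in> mod_hom R (?Q i) (?Q (Suc i))"
    and d\<phi>: "\<And>i x. x \<in> carrier (?Q (Suc (Suc i))) \<Longrightarrow> ?d i (\<phi> (Suc i) x) = \<phi> i (?b (Suc i) x)"
    and b\<psi>: "\<And>i x. x \<in> carrier (?P (Suc i)) \<Longrightarrow> ?b (Suc i) (\<psi> (Suc i) x) = \<psi> i (?d i x)"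
    and htpy: "\<And>i x. x \<in> carrier (?Q (Suc i)) \<Longrightarrow> x = \<psi> i (\<phi> i x) \<oplus>\<^bsub>?Q (Suc i)\<^esub>
        (?b (Suc i) (h (Suc i) x) \<oplus>\<^bsub>?Q (Suc i)\<^esub> h i (?b i x))"
    using syzygy_comparison[OF K F \<epsilon> K'] by metis
  have keys: "Poly_Mapping.keys (?push f c) \<subseteq> carrier N \<times> carrier Y"
    if "Poly_Mapping.keys c \<subseteq> carrier N \<times> carrier X" "f \<in> mod_hom R X Y" for f X Y c
    by (rule frag_map2_keys[OF that(1)]) (use mod_homD(1)[OF that(2)] in auto)
  fix z assume z: "Poly_Mapping.keys z \<subseteq> carrier N \<times> carrier (?Q (Suc (Suc m)))"
    and cycle: "?push (?b (Suc m)) z \<in> tensor_rels R N (?Q (Suc m))"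
  have "?push (?d m) (?push (\<phi> (Suc m)) z) = ?push (\<phi> m) (?push (?b (Suc m)) z)"
    unfolding frag_map2_compose by (rule frag_map2_cong[OF z refl d\<phi>])
  also have "\<dots> \<in> tensor_rels R N (?P m)"
    by (rule frag_map2_rels[OF tQ tP mod_hom_id \<phi> cycle])
  finally obtain w where w: "Poly_Mapping.keys w \<subseteq> carrier N \<times> carrier (?P (Suc (Suc m)))"
    and w_rel: "?push (\<phi> (Suc m)) z - ?push (?d (Suc m)) w \<in> tensor_rels R N (?P (Suc m))"
    using Tor_trivialD[OF van K'(1) N keys[OF z \<phi>]] by blast
  let ?S = "Suc (Suc m)"
  have bh: "(\<lambda>x. ?b ?S (h ?S x)) \<in> mod_hom R (?Q ?S) (?Q ?S)" by (rule mod_hom_compose[OF h Q(3)])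
  have hb: "(\<lambda>x. h (Suc m) (?b (Suc m) x)) \<in> mod_hom R (?Q ?S) (?Q ?S)" by (rule mod_hom_compose[OF Q(3) h])
  have \<psi>\<phi>: "(\<lambda>x. \<psi> (Suc m) (\<phi> (Suc m) x)) \<in> mod_hom R (?Q ?S) (?Q ?S)"
    by (rule mod_hom_compose[OF \<phi> \<psi>])
  let ?bh = "?push (\<lambda>x. ?b ?S (h ?S x)) z" and ?hb = "?push (\<lambda>x. h (Suc m) (?b (Suc m) x)) z"
    and ?\<psi>\<phi> = "?push (\<lambda>x. \<psi> (Suc m) (\<phi> (Suc m) x)) z"
    and ?sum = "?push (\<lambda>x. ?b ?S (h ?S x) \<oplus>\<^bsub>?Q ?S\<^esub> h (Suc m) (?b (Suc m) x)) z"
  \<comment> \<open>The relations \<open>r1\<close> to \<open>r4\<close> are the steps from \<open>z\<close> to the boundary of \<open>\<psi> w + h z\<close>; they add up.\<close>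
  have "z = ?push (\<lambda>p. p) z" by (simp only: frag_map2_id)
  also have "\<dots> = ?push (\<lambda>x. \<psi> (Suc m) (\<phi> (Suc m) x) \<oplus>\<^bsub>?Q ?S\<^esub>
      (?b ?S (h ?S x) \<oplus>\<^bsub>?Q ?S\<^esub> h (Suc m) (?b (Suc m) x))) z"
    by (rule frag_map2_cong[OF z refl htpy])
  finally have r1: "z - (?\<psi>\<phi> + ?sum) \<in> TQ.rels ?S"
    using TQ.frag_map2_add_rels[OF Q(1) \<psi>\<phi> mod_hom_add[OF Q(1) bh hb] z] by simp
  have r2: "?sum - (?bh + ?hb) \<in> TQ.rels ?S"
    by (rule TQ.frag_map2_add_rels[OF Q(1) bh hb z])
  have r3: "?hb \<in> TQ.rels ?S"
    using frag_map2_rels[OF tQ tQ mod_hom_id h cycle] by (simp only: frag_map2_compose)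
  have "?push (\<psi> (Suc m)) (?push (?d (Suc m)) w) = ?push (?b ?S) (?push (\<psi> ?S) w)"
    unfolding frag_map2_compose by (rule frag_map2_cong[OF w refl b\<psi>[symmetric]])
  then have r4: "?\<psi>\<phi> - ?push (?b ?S) (?push (\<psi> ?S) w) \<in> TQ.rels ?S"
    using frag_map2_rels[OF tP tQ mod_hom_id \<psi> w_rel] by (simp only: frag_map2_simps frag_map2_compose)
  have bh: "?bh = ?push (?b ?S) (?push (h ?S) z)" by (simp only: frag_map2_compose)
  let ?w = "?push (\<psi> ?S) w + ?push (h ?S) z"
  have "z - ?push (?b ?S) ?w = (z - (?\<psi>\<phi> + ?sum)) + (?sum - (?bh + ?hb)) + ?hb
      + (?\<psi>\<phi> - ?push (?b ?S) (?push (\<psi> ?S) w))"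
    by (simp only: frag_map2_simps(3) bh) (simp add: algebra_simps)
  also have "\<dots> \<in> TQ.rels ?S" by (intro TQ.rels_add r1 r2 r3 r4)
  finally show "\<exists>w. Poly_Mapping.keys w \<subseteq> carrier N \<times> carrier (?Q (Suc ?S)) \<and>
      z - ?push (?b ?S) w \<in> TQ.rels ?S"
    using keys_add_subset[OF keys[OF w \<psi>] keys[OF z h]] by (intro exI[of _ ?w] conjI)
qed

text \<open>
  The part \<open>Tor\<^sub>m\<^sub>+\<^sub>2(C, K) \<rightarrow> Tor\<^sub>m\<^sub>+\<^sub>1(A, K) \<rightarrow> Tor\<^sub>m\<^sub>+\<^sub>1(B, K)\<close> of the long exact sequence, again by
  the diagram chase: a cycle \<open>z\<close> over \<open>A\<close> bounds some \<open>w\<close> over \<open>B\<close>, the image of \<open>w\<close> over \<open>C\<close> is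
  a cycle and hence a boundary, and after correcting \<open>w\<close> by a lift of the bounding chain it comes
  from \<open>A\<close>, where it bounds \<open>z\<close> because the tensored inclusion is injective.
\<close>

lemma Tor_middle_exact:
  assumes K: "left_module R K" and ses: "short_exact (opposite_ring R) A B C i p"
    and B: "trivial_group (Tor R (Suc m) B K)"
    and C: "trivial_group (Tor R (Suc (Suc m)) C K)"
  shows "trivial_group (Tor R (Suc m) A K)"
proof -
  let ?Q = "free_res R K" and ?b = "res_diff R K"
  let ?push = "\<lambda>j. frag_map2 (\<lambda>x. x) (?b j)" and ?map = "\<lambda>f. frag_map2 f (\<lambda>q. q)"
  note S = short_exactD[OF ses, unfolded mod_hom_opposite_ring] and Q = free_res_maps[OF K]
  have tA: "free_tensor_pair R A (res_gens R K j)" and tB: "free_tensor_pair R B (res_gens R K j)"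
    and tC: "free_tensor_pair R C (res_gens R K j)" for j
    using tensor_pairI[OF S(1) Q(1)[of j]] tensor_pairI[OF S(2) Q(1)[of j]] tensor_pairI[OF S(3) Q(1)[of j]]
    by (simp_all add: free_tensor_pair_def free_res_def)
  have pA: "tensor_pair R A (?Q j)" and pB: "tensor_pair R B (?Q j)" and pC: "tensor_pair R C (?Q j)" for j
    by (rule tensor_pairI[OF S(1) Q(1)], rule tensor_pairI[OF S(2) Q(1)], rule tensor_pairI[OF S(3) Q(1)])
  interpret TB: tensor_pair R B "?Q j" for j by (rule pB)
  interpret TC: tensor_pair R C "?Q j" for j by (rule pC)
  have keys: "Poly_Mapping.keys (frag_map2 f g c) \<subseteq> carrier N' \<times> carrier Y"
    if "Poly_Mapping.keys c \<subseteq> carrier N \<times> carrier X" "f \<in> mod_hom R N N'" "g \<in> mod_hom R X Y" for f g N N' X Y c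
    by (rule frag_map2_keys[OF that(1)]) (use mod_homD(1)[OF that(2)] mod_homD(1)[OF that(3)] in auto)
  have swap: "?push j (?map f c) = ?map f (?push j c)" for j f c
    by (simp only: frag_map2_compose)
  show ?thesis
    unfolding Tor_trivial_iff[OF K S(1)]
  proof (intro allI impI)
    fix z assume z: "Poly_Mapping.keys z \<subseteq> carrier A \<times> carrier (?Q (Suc m))"
      and cycle: "?push m z \<in> tensor_rels R A (?Q m)"
    have iz: "?push m (?map i z) \<in> TB.rels m"
      unfolding swap by (rule frag_map2_rels[OF pA pB S(4) mod_hom_id cycle])
    obtain w where w: "Poly_Mapping.keys w \<subseteq> carrier B \<times> carrier (?Q (Suc (Suc m)))"
      and w_rel: "?map i z - ?push (Suc m) w \<in> TB.rels (Suc m)"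
      by (rule Tor_trivialD[OF B K S(2) keys[OF z S(4) mod_hom_id] iz])
    have "?map p (?map i z) = frag_map2 (\<lambda>_. \<zero>\<^bsub>C\<^esub>) (\<lambda>q. q) z"
      unfolding frag_map2_compose by (rule frag_map2_cong[OF z _ refl]) (use S(8) in blast)
    also have "\<dots> \<in> TC.rels (Suc m)" by (rule TC.frag_map2_zero_rels(2)[OF z])
    finally have piz: "?map p (?map i z) \<in> TC.rels (Suc m)" .
    have "?map p (?map i z - ?push (Suc m) w) \<in> TC.rels (Suc m)"
      by (rule frag_map2_rels[OF pB pC S(5) mod_hom_id w_rel])
    from TC.rels_diff[OF piz this] have pw: "?push (Suc m) (?map p w) \<in> TC.rels (Suc m)"
      by (simp add: swap)
    obtain v where v: "Poly_Mapping.keys v \<subseteq> carrier C \<times> carrier (?Q (Suc (Suc (Suc m))))"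
      and v_rel: "?map p w - ?push (Suc (Suc m)) v \<in> TC.rels (Suc (Suc m))"
      by (rule Tor_trivialD[OF C K S(3) keys[OF w S(5) mod_hom_id] pw])
    obtain v' where v': "Poly_Mapping.keys v' \<subseteq> carrier B \<times> carrier (?Q (Suc (Suc (Suc m))))"
      "?map p v' = v"
      by (rule tensor_surjective[OF S(7) v])
    let ?w = "w - ?push (Suc (Suc m)) v'"
    have "?map p ?w = ?map p w - ?push (Suc (Suc m)) v"
      by (simp add: v'(2) flip: swap)
    with v_rel have pw': "?map p ?w \<in> TC.rels (Suc (Suc m))" by simp
    have w': "Poly_Mapping.keys ?w \<subseteq> carrier B \<times> carrier (?Q (Suc (Suc m)))"
      by (rule keys_diff_subset[OF w keys[OF v'(1) mod_hom_id Q(3)]])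
    have exact: "{x \<in> carrier B. p x = \<zero>\<^bsub>C\<^esub>} \<subseteq> i ` carrier A" using S(8) by simp
    obtain u where u: "Poly_Mapping.keys u \<subseteq> carrier A \<times> carrier (?Q (Suc (Suc m)))"
      and u_rel: "?w - ?map i u \<in> TB.rels (Suc (Suc m))"
      by (rule free_tensor_exact[OF tA tB tC S(4,5) exact w'[unfolded free_res_def] pw'[unfolded free_res_def],
            folded free_res_def])
    have r1: "?push (Suc m) (?w - ?map i u) \<in> TB.rels (Suc m)"
      by (rule frag_map2_rels[OF pB pB mod_hom_id Q(3) u_rel])
    have r2: "?push (Suc m) (?push (Suc (Suc m)) v') \<in> TB.rels (Suc m)"
      by (rule push_push_rels[OF K S(2) v'(1)])
    have "?map i (z - ?push (Suc m) u) =
        (?map i z - ?push (Suc m) w) + (?push (Suc m) (?w - ?map i u) + ?push (Suc m) (?push (Suc (Suc m)) v'))"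
      by (simp add: swap)
    also have "\<dots> \<in> TB.rels (Suc m)" by (intro TB.rels_add w_rel r1 r2)
    finally have "?map i (z - ?push (Suc m) u) \<in> TB.rels (Suc m)" .
    then have "z - ?push (Suc m) u \<in> tensor_rels R A (?Q (Suc m))"
      using free_tensor_injective[OF tA tB S(4,6)] keys_diff_subset[OF z keys[OF u mod_hom_id Q(3)]]
      by (simp only: free_res_def)
    with u show "\<exists>w. Poly_Mapping.keys w \<subseteq> carrier A \<times> carrier (?Q (Suc (Suc m))) \<and>
        z - ?push (Suc m) w \<in> tensor_rels R A (?Q (Suc m))" by blast
  qed
qed

section \<open>The classes of bounded dimension and their closure properties\<close>

text \<open>
  A set of extended naturals attains its infimum when that is finite; the empty set has infimum
  \<open>\<infinity>\<close>. Thus a dimension at most \<open>k\<close> is witnessed by a vanishing degree, not merely approximated.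
\<close>

lemma Inf_enat_le_iff:
  "Inf {enat j | j. P j} \<le> enat k \<longleftrightarrow> (\<exists>j\<le>k. P j)"
proof
  assume le: "Inf {enat j | j. P j} \<le> enat k"
  have "{enat j | j. P j} \<noteq> {}"
  proof
    assume "{enat j | j. P j} = {}"
    with le show False by (simp add: Inf_enat_def)
  qed
  then have "Inf {enat j | j. P j} \<in> {enat j | j. P j}" by (meson enat_ord_number wellorder_InfI ex_in_conv)
  with le show "\<exists>j\<le>k. P j" by auto
next
  assume "\<exists>j\<le>k. P j"
  then obtain j where "j \<le> k" "P j" by blast
  then show "Inf {enat j | j. P j} \<le> enat k"
    by (intro Inf_lower2[of "enat j"]) auto
qed

lemma shift_from:
  assumes step: "\<And>j. P j \<Longrightarrow> P (Suc j)"
  shows "(\<exists>j\<le>k. P j) \<longleftrightarrow> P k"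
  using step by (metis dec_induct order_refl)

text \<open>
  The dimension only asks for vanishing in some degree up to \<open>k + 1\<close>. Since special modules are
  closed under syzygies, dimension shifting propagates vanishing upwards, and the single degree
  \<open>k + 1\<close> decides.
\<close>

lemma WI_iff:
  "M \<in> WI TYPE('u) R n k \<longleftrightarrow> left_module R M \<and>
    (\<forall>K :: ('r, 'u) module. special_super_fp R n K \<longrightarrow> trivial_group (Ext R (Suc k) K M))"
  for R :: "('r, 'x) ring_scheme"
proof (cases "left_module R M")
  case True
  let ?P = "\<lambda>j. \<forall>K :: ('r, 'u) module. special_super_fp R n K \<longrightarrow> trivial_group (Ext R (Suc j) K M)"
  have "?P (Suc j)" if "?P j" for j
  proof (intro allI impI)
    fix K :: "('r, 'u) module" assume "special_super_fp R n K"
    then show "trivial_group (Ext R (Suc (Suc j)) K M)"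
      by (rule special_super_fp_cover) (rule Ext_shift; use True that in blast)
  qed
  then show ?thesis
    using True shift_from[of ?P k] by (simp add: WI_def wid_def Inf_enat_le_iff)
qed (simp add: WI_def)

lemma WF_iff:
  "N \<in> WF TYPE('u) R n k \<longleftrightarrow> right_module R N \<and>
    (\<forall>K :: ('r, 'u) module. special_super_fp R n K \<longrightarrow> trivial_group (Tor R (Suc k) N K))"
  for R :: "('r, 'x) ring_scheme"
proof (cases "right_module R N")
  case True
  let ?P = "\<lambda>j. \<forall>K :: ('r, 'u) module. special_super_fp R n K \<longrightarrow> trivial_group (Tor R (Suc j) N K)"
  have "?P (Suc j)" if "?P j" for j
  proof (intro allI impI)
    fix K :: "('r, 'u) module" assume "special_super_fp R n K"
    then show "trivial_group (Tor R (Suc (Suc j)) N K)"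
      by (rule special_super_fp_cover) (rule Tor_shift; use True that in blast)
  qed
  then show ?thesis
    using True shift_from[of ?P k] by (simp add: WF_def wfd_def Inf_enat_le_iff)
qed (simp add: WF_def)

lemma WI_mono_step: "M \<in> WI u R n k \<Longrightarrow> M \<in> WI u R n (Suc k)"
  by (auto simp: WI_def intro: order_trans)

lemma WF_mono_step: "M \<in> WF u R n k \<Longrightarrow> M \<in> WF u R n (Suc k)"
  by (auto simp: WF_def intro: order_trans)

lemma special_super_fp_left_module: "special_super_fp R n K \<Longrightarrow> left_module R K"
  by (rule special_super_fp_cover)

theorem corollary3p4:
  fixes R :: "('r, 'x) ring_scheme" and n k :: nat
  assumes "ring R"
  shows "(\<forall>(A :: ('r, 'a) module) (B :: ('r, 'b) module) (C :: ('r, 'c) module) f g.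
            short_exact R A B C f g \<longrightarrow>
            A \<in> WI TYPE('u) R n k \<longrightarrow> B \<in> WI TYPE('u) R n k \<longrightarrow> C \<in> WI TYPE('u) R n k)
       \<and> (\<forall>(A :: ('r, 'd) module) (B :: ('r, 'e) module) (C :: ('r, 'f) module) f g.
            short_exact (opposite_ring R) A B C f g \<longrightarrow>
            B \<in> WF TYPE('u) R n k \<longrightarrow> C \<in> WF TYPE('u) R n k \<longrightarrow> A \<in> WF TYPE('u) R n k)"
proof (intro conjI allI impI)
  fix A :: "('r, 'a) module" and B :: "('r, 'b) module" and C :: "('r, 'c) module" and f g
  assume ses: "short_exact R A B C f g"
    and A: "A \<in> WI TYPE('u) R n k" and B: "B \<in> WI TYPE('u) R n k"
  show "C \<in> WI TYPE('u) R n k"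
    unfolding WI_iff
  proof (intro conjI allI impI short_exactD(3)[OF ses])
    fix K :: "('r, 'u) module" assume K: "special_super_fp R n K"
    show "trivial_group (Ext R (Suc k) K C)"
      by (rule Ext_middle_exact[OF special_super_fp_left_module[OF K] ses])
         (use WI_mono_step[OF A] B K in \<open>simp_all add: WI_iff\<close>)
  qed
next
  fix A :: "('r, 'd) module" and B :: "('r, 'e) module" and C :: "('r, 'f) module" and f g
  assume ses: "short_exact (opposite_ring R) A B C f g"
    and B: "B \<in> WF TYPE('u) R n k" and C: "C \<in> WF TYPE('u) R n k"
  show "A \<in> WF TYPE('u) R n k"
    unfolding WF_iff
  proof (intro conjI allI impI short_exactD(1)[OF ses])
    fix K :: "('r, 'u) module" assume K: "special_super_fp R n K"
    show "trivial_group (Tor R (Suc k) A K)"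
      by (rule Tor_middle_exact[OF special_super_fp_left_module[OF K] ses])
         (use WF_mono_step[OF C] B K in \<open>simp_all add: WF_iff\<close>)
  qed
qed

end
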